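(* Let $(\Omega,\mathcal A,\mu)$ be a $\sigma$-finite measure space with $\mu(\Omega)=\infty$ which is quasi-non-atomic. Then $\mathcal C_\mu=\mathcal R_\mu$.
   Context: $(\Omega,\mathcal A,\mu)$ is a complete measure space. $\mathcal L^0=\mathcal L^0(\Omega)$ is the algebra of equivalence classes of a.e. finite real-valued measurable functions on $\Omega$, and $\mathcal L^p=\mathcal L^p(\Omega)\subset\mathcal L^0$ ($1\le p\le\infty$) is the real $L^p$-space with its standard norm $\|\cdot\|_p$; $\mathcal L^1+\mathcal L^\infty=\{g+h: g\in\mathcal L^1,\ h\in\mathcal L^\infty\}$. The measure space $(\Omega,\mu)$ is called quasi-non-atomic if it has finitely many atoms (possibly none) or all its atoms have the same measure. For $f\in\mathcal L^1+\mathcal L^\infty$ the non-increasing rearrangement is $\mu_t(f)=\inf\{\lambda>0:\ \mu\{|f|>\lambda\}\le t\}$, $t>0$, and $$\mathcal R_\mu=\{f\in\mathcal L^1+\mathcal L^\infty:\ \mu_t(f)\to 0 \text{ as } t\to\infty\},$$ equivalently, the set of $f\in\mathcal L^1+\mathcal L^\infty$ with $\mu\{|f|>\lambda\}<\infty$ for all $\lambda>0$. A linear operator $T:\mathcal L^1+\mathcal L^\infty\to\mathcal L^1+\mathcal L^\infty$ is a Dunford-Schwartz operator (written $T\in DS$) if $\|T(f)\|_1\le\|f\|_1$ for all $f\in\mathcal L^1$ and $\|T(f)\|_\infty\le\|f\|_\infty$ for all $f\in\mathcal L^\infty$. Its ergodic averages are $A_n(T,f)=\frac1n\sum_{k=0}^{n-1}T^k(f)$,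 and $$\mathcal C_\mu=\{f\in\mathcal L^1+\mathcal L^\infty:\ \{A_n(T,f)\}_n \text{ converges a.e. (to a finite limit) for all } T\in DS\}.$$ *)

theory Defs
  imports "HOL-Analysis.Analysis" "HOL-Probability.Essential_Supremum"
begin

text \<open>
  Elements of $L^0$ are represented by everywhere finite measurable functions; a set of classes
  is represented by the set of all its representatives, which is closed under a.e. equality, and
  an operator on classes by an operator on representatives that respects a.e. equality (every
  operator on classes arises in this way, by choosing representatives of its values).
\<close>

definition L1_norm :: "'a measure \<Rightarrow> ('a \<Rightarrow> real) \<Rightarrow> ennreal" where
  "L1_norm M f = (\<integral>\<^sup>+ x. ennreal \<bar>f x\<bar> \<partial>M)"

definition Linf_norm :: "'a measure \<Rightarrow> ('a \<Rightarrow> real) \<Rightarrow> ennreal" where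
  "Linf_norm M f = esssup M (\<lambda>x. ennreal \<bar>f x\<bar>)"

definition L1_space :: "'a measure \<Rightarrow> ('a \<Rightarrow> real) set" where
  "L1_space M = {f \<in> borel_measurable M. L1_norm M f < \<infinity>}"

definition Linf_space :: "'a measure \<Rightarrow> ('a \<Rightarrow> real) set" where
  "Linf_space M = {f \<in> borel_measurable M. Linf_norm M f < \<infinity>}"

definition L1_plus_Linf :: "'a measure \<Rightarrow> ('a \<Rightarrow> real) set" where
  "L1_plus_Linf M = {f. \<exists>g\<in>L1_space M. \<exists>h\<in>Linf_space M. f = (\<lambda>x. g x + h x)}"

definition atom_of :: "'a measure \<Rightarrow> 'a set \<Rightarrow> bool" where
  "atom_of M A \<longleftrightarrow> A \<in> sets M \<and> 0 < emeasure M A \<and>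
     (\<forall>B\<in>sets M. B \<subseteq> A \<longrightarrow> emeasure M B = 0 \<or> emeasure M (A - B) = 0)"

text \<open>Atoms are counted up to null sets.\<close>

definition ae_equal_sets :: "'a measure \<Rightarrow> ('a set \<times> 'a set) set" where
  "ae_equal_sets M =
     {(A, B). A \<in> sets M \<and> B \<in> sets M \<and> emeasure M ((A - B) \<union> (B - A)) = 0}"

definition quasi_non_atomic :: "'a measure \<Rightarrow> bool" where
  "quasi_non_atomic M \<longleftrightarrow>
     finite ({A. atom_of M A} // ae_equal_sets M) \<or>
     (\<forall>A B. atom_of M A \<longrightarrow> atom_of M B \<longrightarrow> emeasure M A = emeasure M B)"

text \<open>
  For $f \in L^1 + L^\infty$ and $t > 0$ the set below is nonempty and bounded below, so the real
  infimum is the genuine one.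
\<close>

definition rearrangement :: "'a measure \<Rightarrow> ('a \<Rightarrow> real) \<Rightarrow> real \<Rightarrow> real" where
  "rearrangement M f t =
     Inf {l. 0 < l \<and> emeasure M {x \<in> space M. \<bar>f x\<bar> > l} \<le> ennreal t}"

definition R_space :: "'a measure \<Rightarrow> ('a \<Rightarrow> real) set" where
  "R_space M = {f \<in> L1_plus_Linf M. (rearrangement M f \<longlongrightarrow> 0) at_top}"

text \<open>
  The two norm conditions also say that the operator maps $L^1$ and $L^\infty$ into themselves,
  as the norms take the value $\infty$ outside these spaces.
\<close>

definition dunford_schwartz ::
    "'a measure \<Rightarrow> (('a \<Rightarrow> real) \<Rightarrow> 'a \<Rightarrow> real) \<Rightarrow> bool" where
  "dunford_schwartz M T \<longleftrightarrow>
     (\<forall>f\<in>L1_plus_Linf M. T f \<in> L1_plus_Linf M) \<and>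
     (\<forall>f\<in>L1_plus_Linf M. \<forall>g\<in>L1_plus_Linf M.
        (AE x in M. f x = g x) \<longrightarrow> (AE x in M. T f x = T g x)) \<and>
     (\<forall>f\<in>L1_plus_Linf M. \<forall>g\<in>L1_plus_Linf M. \<forall>a b.
        AE x in M. T (\<lambda>y. a * f y + b * g y) x = a * T f x + b * T g x) \<and>
     (\<forall>f\<in>L1_space M. L1_norm M (T f) \<le> L1_norm M f) \<and>
     (\<forall>f\<in>Linf_space M. Linf_norm M (T f) \<le> Linf_norm M f)"

text \<open>Meaningful for $n \ge 1$; the junk value at $n = 0$ does not affect convergence.\<close>

definition ergodic_average ::
    "(('a \<Rightarrow> real) \<Rightarrow> 'a \<Rightarrow> real) \<Rightarrow> nat \<Rightarrow> ('a \<Rightarrow> real) \<Rightarrow> 'a \<Rightarrow> real" where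
  "ergodic_average T n f x = (1 / real n) * (\<Sum>k<n. (T ^^ k) f x)"

definition C_space :: "'a measure \<Rightarrow> ('a \<Rightarrow> real) set" where
  "C_space M = {f \<in> L1_plus_Linf M.
     \<forall>T. dunford_schwartz M T \<longrightarrow> (AE x in M. convergent (\<lambda>n. ergodic_average T n f x))}"

end

theory Submission
  imports Defs "HOL-Library.Discrete_Functions"
begin

text \<open>
  A function of $L^1 + L^\infty$ has vanishing rearrangement iff all sets $\{|f| > \lambda\}$,
  $\lambda > 0$, have finite measure (\<open>R_space_iff\<close>), and the two inclusions are proved
  in this form.

  Convergence. Suppose all these sets have finite measure and let $T$ be a Dunford-Schwartz
  operator. It may change signs, so the maximal inequality is obtained from Chacon's filling scheme,
  in which a signed mass is moved by $T$ and absorbed up to a given capacity. Since the part of a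
  function below height $a$ contributes at most $a$ to any average, the scheme controls the measure of
  $\{\sup_n |A_n f| > 2a\}$ by $\frac1a \int (|f| - a)^+$ (\<open>maximal_inequality\<close>).
  Consequently the set of $f$ with almost everywhere convergent averages is closed under approximation
  in which the integrals $\int (|f - b|\, - a)^+$ become small for every $a > 0$
  (\<open>banach_principle\<close>), and it remains to find enough functions with convergent averages.
  The same truncation shows that $T$ does not increase $\int (|f| - a)^+$; integrating over $a$
  gives $\|Tf\|_2 \le \|f\|_2$. In $L^2$ an element of minimal norm
  in the closure of $f + (I - T)D$, with $D$ the bounded square integrable functions, is
  invariant (\<open>mean_ergodic_decomposition\<close>). So $f$ is approximated by invariant functions
  plus coboundaries $g - Tg$ with bounded $g$, whose averages converge, the latter because they
  telescope. Finally, a function whose level sets have finite measure is approximated by its bounded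
  square integrable truncations (\<open>average_convergent\<close>).

  Divergence. Suppose $\{f > \lambda\}$ or $\{f < -\lambda\}$ has infinite measure. By
  $\sigma$-finiteness it contains disjoint sets $E_1, E_2, \ldots$ of finite, positive,
  nondecreasing measure (\<open>exists_level_chain\<close>). Let $Tf$ equal, on $E_j$, the mean of
  $f$ over $E_{j+1}$ times a sign. This contracts $L^\infty$, and it contracts $L^1$ since
  $\mu(E_j) \le \mu(E_{j+1})$. On $E_1$ the iterate $T^k f$ is a sign times the mean of
  $f$ over $E_{k+1}$, of modulus at least $\lambda$. Choosing the signs constant on blocks
  $2^j \le k < 2^{j+1}$ and alternating with $j$ makes the averages diverge on $E_1$
  (\<open>divergent_average_of_level_chain\<close>).
\<close>

section \<open>Truncation, excess, and the space $L^1 + L^\infty$\<close>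

definition clip :: "real \<Rightarrow> real \<Rightarrow> real" where
  "clip c y = max (- c) (min c y)"

lemma abs_clip_le: "0 \<le> c \<Longrightarrow> \<bar>clip c y\<bar> \<le> c"
  by (auto simp: clip_def)

lemma abs_diff_clip: "0 \<le> c \<Longrightarrow> \<bar>y - clip c y\<bar> = max 0 (\<bar>y\<bar> - c)"
  by (auto simp: clip_def max_def min_def abs_if)

lemma abs_clip_add_abs_diff_clip: "0 \<le> c \<Longrightarrow> \<bar>clip c y\<bar> + \<bar>y - clip c y\<bar> = \<bar>y\<bar>"
  by (auto simp: clip_def max_def min_def abs_if)

lemma abs_clip_eq: "0 \<le> c \<Longrightarrow> y \<noteq> clip c y \<Longrightarrow> \<bar>clip c y\<bar> = c"
  by (auto simp: clip_def max_def min_def abs_if split: if_splits)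

lemma borel_measurable_clip [measurable]:
  assumes [measurable]: "c \<in> borel_measurable M" "f \<in> borel_measurable M"
  shows "(\<lambda>x. clip (c x) (f x)) \<in> borel_measurable M"
  unfolding clip_def by measurable

text \<open>As \<open>ennreal\<close> sends negative numbers to zero, this is $\int (|f| - a)^+$, and for
  \<open>a = 0\<close> it is the $L^1$ norm.\<close>

definition excess :: "'a measure \<Rightarrow> real \<Rightarrow> ('a \<Rightarrow> real) \<Rightarrow> ennreal" where
  "excess M a f = (\<integral>\<^sup>+ x. ennreal (\<bar>f x\<bar> - a) \<partial>M)"

lemma ennreal_le_add_positive_parts:
  assumes "x \<le> max 0 y + max 0 z"
  shows "ennreal x \<le> ennreal y + ennreal z"
proof -
  have "ennreal x \<le> ennreal (max 0 y + max 0 z)"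
    using assms by (rule ennreal_leI)
  also have "\<dots> = ennreal (max 0 y) + ennreal (max 0 z)"
    by (rule ennreal_plus) auto
  also have "\<dots> = ennreal y + ennreal z"
    by (simp add: max_def ennreal_neg)
  finally show ?thesis .
qed

lemma excess_add_le:
  assumes [measurable]: "f \<in> borel_measurable M" "g \<in> borel_measurable M"
  shows "excess M (a + b) (\<lambda>x. f x + g x) \<le> excess M a f + excess M b g"
proof -
  have "excess M (a + b) (\<lambda>x. f x + g x)
      \<le> (\<integral>\<^sup>+ x. (ennreal (\<bar>f x\<bar> - a) + ennreal (\<bar>g x\<bar> - b)) \<partial>M)"
    unfolding excess_def
    by (intro nn_integral_mono ennreal_le_add_positive_parts) auto
  also have "\<dots> = excess M a f + excess M b g"
    unfolding excess_def by (rule nn_integral_add) auto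
  finally show ?thesis .
qed

lemma excess_cmult:
  assumes [measurable]: "f \<in> borel_measurable M"
  shows "excess M (\<bar>c\<bar> * a) (\<lambda>x. c * f x) = ennreal \<bar>c\<bar> * excess M a f"
proof -
  have "ennreal (\<bar>c * f x\<bar> - \<bar>c\<bar> * a) = ennreal \<bar>c\<bar> * ennreal (\<bar>f x\<bar> - a)" for x
    by (simp add: abs_mult ennreal_mult'' right_diff_distrib [symmetric] ennreal_mult')
  then show ?thesis
    unfolding excess_def by (simp add: nn_integral_cmult)
qed

lemma L1_space_iff:
  "f \<in> L1_space M \<longleftrightarrow> f \<in> borel_measurable M \<and> excess M 0 f < \<infinity>"
  by (simp add: L1_space_def L1_norm_def excess_def)

lemma Linf_norm_le_iff:
  assumes [measurable]: "f \<in> borel_measurable M" and "0 \<le> B"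
  shows "Linf_norm M f \<le> ennreal B \<longleftrightarrow> (AE x in M. \<bar>f x\<bar> \<le> B)"
proof
  assume "Linf_norm M f \<le> ennreal B"
  moreover have "AE x in M. ennreal \<bar>f x\<bar> \<le> Linf_norm M f"
    unfolding Linf_norm_def by (rule esssup_AE)
  ultimately have "AE x in M. ennreal \<bar>f x\<bar> \<le> ennreal B"
    by (auto intro: order_trans)
  then show "AE x in M. \<bar>f x\<bar> \<le> B"
    using \<open>0 \<le> B\<close> by simp
next
  assume "AE x in M. \<bar>f x\<bar> \<le> B"
  then show "Linf_norm M f \<le> ennreal B"
    unfolding Linf_norm_def by (intro esssup_I) (auto intro: ennreal_leI)
qed

lemma Linf_space_iff:
  "f \<in> Linf_space M \<longleftrightarrow> f \<in> borel_measurable M \<and> (\<exists>B\<ge>0. AE x in M. \<bar>f x\<bar> \<le> B)"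
proof (cases "f \<in> borel_measurable M")
  case True
  have "Linf_norm M f < \<infinity> \<longleftrightarrow> (\<exists>B\<ge>0. Linf_norm M f \<le> ennreal B)"
    by (metis ennreal_less_top infinity_ennreal_def le_less_trans ennreal_cases
        order_refl less_irrefl)
  with True show ?thesis
    by (auto simp: Linf_space_def Linf_norm_le_iff)
qed (simp add: Linf_space_def)

text \<open>Cutting at the height of the bounded summand leaves an integrable remainder, so a
  function of $L^1 + L^\infty$ may always be split by truncating its values.\<close>

lemma L1_plus_Linf_iff:
  "f \<in> L1_plus_Linf M \<longleftrightarrow> f \<in> borel_measurable M \<and> (\<exists>a\<ge>0. excess M a f < \<infinity>)"
proof
  assume "f \<in> L1_plus_Linf M"
  then obtain g h where g: "g \<in> L1_space M" and h: "h \<in> Linf_space M"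
    and f: "f = (\<lambda>x. g x + h x)"
    by (auto simp: L1_plus_Linf_def)
  have [measurable]: "g \<in> borel_measurable M" "h \<in> borel_measurable M"
    using g h by (auto simp: L1_space_iff Linf_space_iff)
  obtain B where B: "0 \<le> B" "AE x in M. \<bar>h x\<bar> \<le> B"
    using h by (auto simp: Linf_space_iff)
  have "excess M B f \<le> excess M 0 g"
    unfolding excess_def f using B(2)
    by (intro nn_integral_mono_AE) (auto intro!: ennreal_leI)
  also have "\<dots> < \<infinity>"
    using g by (simp add: L1_space_iff)
  finally show "f \<in> borel_measurable M \<and> (\<exists>a\<ge>0. excess M a f < \<infinity>)"
    using B(1) f by auto
next
  assume *: "f \<in> borel_measurable M \<and> (\<exists>a\<ge>0. excess M a f < \<infinity>)"
  then have [measurable]: "f \<in> borel_measurable M" by simp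
  from * obtain a where a: "0 \<le> a" "excess M a f < \<infinity>" by auto
  have "excess M 0 (\<lambda>x. f x - clip a (f x)) = excess M a f"
    unfolding excess_def using a(1)
    by (intro nn_integral_cong) (auto simp: abs_diff_clip max_def ennreal_neg)
  then have "(\<lambda>x. f x - clip a (f x)) \<in> L1_space M"
    using a(2) by (simp add: L1_space_iff)
  moreover have "(\<lambda>x. clip a (f x)) \<in> Linf_space M"
    using a(1) abs_clip_le[OF a(1)] by (auto simp: Linf_space_iff)
  ultimately have "(\<lambda>x. (f x - clip a (f x)) + clip a (f x)) \<in> L1_plus_Linf M"
    unfolding L1_plus_Linf_def mem_Collect_eq by (intro bexI) (rule refl)
  then show "f \<in> L1_plus_Linf M" by simp
qed

lemma L1_plus_Linf_measurable [measurable_dest]: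
  "f \<in> L1_plus_Linf M \<Longrightarrow> f \<in> borel_measurable M"
  by (simp add: L1_plus_Linf_iff)

lemma bounded_in_L1_plus_Linf:
  assumes "f \<in> borel_measurable M" "AE x in M. \<bar>f x\<bar> \<le> B" "0 \<le> B"
  shows "f \<in> L1_plus_Linf M"
proof -
  have "excess M B f = (\<integral>\<^sup>+ x. 0 \<partial>M)"
    unfolding excess_def using assms(2)
    by (intro nn_integral_cong_AE) (auto simp: ennreal_neg)
  then show ?thesis
    using assms(1,3) by (auto simp: L1_plus_Linf_iff intro!: exI[of _ B])
qed

lemma L1_plus_Linf_linear:
  assumes "f \<in> L1_plus_Linf M" "g \<in> L1_plus_Linf M"
  shows "(\<lambda>x. c * f x + d * g x) \<in> L1_plus_Linf M"
proof -
  have [measurable]: "f \<in> borel_measurable M" "g \<in> borel_measurable M"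
    using assms by measurable
  obtain a b where ab: "0 \<le> a" "excess M a f < \<infinity>" "0 \<le> b" "excess M b g < \<infinity>"
    using assms by (auto simp: L1_plus_Linf_iff)
  have "excess M (\<bar>c\<bar> * a + \<bar>d\<bar> * b) (\<lambda>x. c * f x + d * g x)
      \<le> ennreal \<bar>c\<bar> * excess M a f + ennreal \<bar>d\<bar> * excess M b g"
    by (rule order_trans[OF excess_add_le]) (auto simp: excess_cmult)
  also have "\<dots> < \<infinity>"
    using ab by (simp add: ennreal_mult_less_top)
  finally show ?thesis
    using ab by (auto simp: L1_plus_Linf_iff intro!: exI[of _ "\<bar>c\<bar> * a + \<bar>d\<bar> * b"])
qed

lemma L1_plus_Linf_add:
  "f \<in> L1_plus_Linf M \<Longrightarrow> g \<in> L1_plus_Linf M \<Longrightarrow> (\<lambda>x. f x + g x) \<in> L1_plus_Linf M"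
  using L1_plus_Linf_linear[of f M g 1 1] by simp

lemma L1_plus_Linf_diff:
  "f \<in> L1_plus_Linf M \<Longrightarrow> g \<in> L1_plus_Linf M \<Longrightarrow> (\<lambda>x. f x - g x) \<in> L1_plus_Linf M"
  using L1_plus_Linf_linear[of f M g 1 "-1"] by simp

lemma L1_plus_Linf_zero: "(\<lambda>x. 0) \<in> L1_plus_Linf M"
  by (rule bounded_in_L1_plus_Linf[where B = 0]) auto

lemma L1_plus_Linf_sum:
  "(\<And>k. F k \<in> L1_plus_Linf M) \<Longrightarrow> (\<lambda>x. \<Sum>k<(n::nat). F k x) \<in> L1_plus_Linf M"
  by (induction n) (auto intro: L1_plus_Linf_zero L1_plus_Linf_add)

lemma finite_excess_in_L1_plus_Linf:
  "f \<in> borel_measurable M \<Longrightarrow> 0 \<le> a \<Longrightarrow> excess M a f < \<infinity> \<Longrightarrow> f \<in> L1_plus_Linf M"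
  by (auto simp: L1_plus_Linf_iff)

section \<open>Dunford-Schwartz operators\<close>

locale dunford_schwartz_operator = sigma_finite_measure M
  for M :: "'a measure" +
  fixes T :: "('a \<Rightarrow> real) \<Rightarrow> 'a \<Rightarrow> real"
  assumes dunford_schwartz: "dunford_schwartz M T"
begin

abbreviation "V \<equiv> L1_plus_Linf M"

lemma T_closed: "f \<in> V \<Longrightarrow> T f \<in> V"
  using dunford_schwartz by (auto simp: dunford_schwartz_def)

lemma T_cong: "f \<in> V \<Longrightarrow> g \<in> V \<Longrightarrow> AE x in M. f x = g x \<Longrightarrow> AE x in M. T f x = T g x"
  using dunford_schwartz by (auto simp: dunford_schwartz_def)

lemma T_linear:
  "f \<in> V \<Longrightarrow> g \<in> V \<Longrightarrow> AE x in M. T (\<lambda>y. a * f y + b * g y) x = a * T f x + b * T g x"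
  using dunford_schwartz by (auto simp: dunford_schwartz_def)

lemma T_add: "f \<in> V \<Longrightarrow> g \<in> V \<Longrightarrow> AE x in M. T (\<lambda>y. f y + g y) x = T f x + T g x"
  using T_linear[of f g 1 1] by simp

lemma T_diff: "f \<in> V \<Longrightarrow> g \<in> V \<Longrightarrow> AE x in M. T (\<lambda>y. f y - g y) x = T f x - T g x"
  using T_linear[of f g 1 "-1"] by simp

lemma T_bounded:
  assumes f: "f \<in> borel_measurable M" "AE x in M. \<bar>f x\<bar> \<le> B" "0 \<le> B"
  shows "AE x in M. \<bar>T f x\<bar> \<le> B"
proof -
  have "T f \<in> V"
    using f by (intro T_closed bounded_in_L1_plus_Linf)
  then have [measurable]: "T f \<in> borel_measurable M" by measurable
  have "f \<in> Linf_space M"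
    using f by (auto simp: Linf_space_iff)
  then have "Linf_norm M (T f) \<le> Linf_norm M f"
    using dunford_schwartz by (auto simp: dunford_schwartz_def)
  also have "\<dots> \<le> ennreal B"
    using f by (simp add: Linf_norm_le_iff)
  finally show ?thesis
    using f by (simp add: Linf_norm_le_iff)
qed

text \<open>At most \<open>a\<close> of the image can come from the part of \<open>f\<close> below height \<open>a\<close>, so
  what exceeds \<open>a\<close> is dominated by the image of the integrable part above it.\<close>

lemma T_excess_le:
  assumes f: "f \<in> V" and a: "0 \<le> a"
  shows "excess M a (T f) \<le> excess M a f"
proof (cases "excess M a f < \<infinity>")
  case True
  have [measurable]: "f \<in> borel_measurable M" using f by measurable
  define r where "r x = f x - clip a (f x)" for x
  have [measurable]: "r \<in> borel_measurable M" unfolding r_def by measurable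
  have r_excess: "excess M 0 r = excess M a f"
    unfolding excess_def r_def using a
    by (intro nn_integral_cong) (auto simp: abs_diff_clip max_def ennreal_neg)
  then have r1: "r \<in> L1_space M"
    using True by (simp add: L1_space_iff)
  have rV: "r \<in> V"
    using True r_excess by (intro finite_excess_in_L1_plus_Linf[of _ _ 0]) auto
  have c_bound: "AE x in M. \<bar>clip a (f x)\<bar> \<le> a"
    using abs_clip_le[OF a] by simp
  have cV: "(\<lambda>x. clip a (f x)) \<in> V"
    using c_bound a by (intro bounded_in_L1_plus_Linf) auto
  have "AE x in M. T (\<lambda>y. clip a (f y) + r y) x = T (\<lambda>y. clip a (f y)) x + T r x"
    by (rule T_add[OF cV rV])
  moreover have "(\<lambda>y. clip a (f y) + r y) = f"
    by (simp add: r_def)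
  ultimately have split: "AE x in M. T f x = T (\<lambda>y. clip a (f y)) x + T r x" by simp
  have "AE x in M. \<bar>T (\<lambda>y. clip a (f y)) x\<bar> \<le> a"
    using c_bound a by (intro T_bounded) auto
  then have "AE x in M. \<bar>T f x\<bar> - a \<le> \<bar>T r x\<bar>"
    using split by eventually_elim simp
  then have "excess M a (T f) \<le> excess M 0 (T r)"
    unfolding excess_def by (intro nn_integral_mono_AE) (auto intro: ennreal_leI)
  also have "\<dots> \<le> excess M 0 r"
    using r1 dunford_schwartz by (auto simp: dunford_schwartz_def L1_norm_def excess_def)
  finally show ?thesis
    using r_excess by simp
qed (simp add: top.not_eq_extremum[symmetric])

lemma T_sum:
  assumes "\<And>k. F k \<in> V"
  shows "AE x in M. T (\<lambda>y. \<Sum>k<(n::nat). F k y) x = (\<Sum>k<n. T (F k) x)"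
proof (induction n)
  case 0
  show ?case
    using T_linear[OF L1_plus_Linf_zero L1_plus_Linf_zero, of 0 0] by simp
next
  case (Suc n)
  have "AE x in M. T (\<lambda>y. (\<Sum>k<n. F k y) + F n y) x = T (\<lambda>y. \<Sum>k<n. F k y) x + T (F n) x"
    using assms by (intro T_add L1_plus_Linf_sum) auto
  then show ?case
    using Suc by eventually_elim simp
qed

lemma iter_closed: "f \<in> V \<Longrightarrow> (T ^^ k) f \<in> V"
  by (induction k) (auto intro: T_closed)

lemma iter_linear:
  assumes "f \<in> V" "g \<in> V"
  shows "AE x in M. (T ^^ k) (\<lambda>y. a * f y + b * g y) x = a * (T ^^ k) f x + b * (T ^^ k) g x"
proof (induction k)
  case (Suc k)
  have "AE x in M. T ((T ^^ k) (\<lambda>y. a * f y + b * g y)) x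
      = T (\<lambda>y. a * (T ^^ k) f y + b * (T ^^ k) g y) x"
    using assms Suc by (intro T_cong iter_closed L1_plus_Linf_linear) auto
  moreover have "AE x in M. T (\<lambda>y. a * (T ^^ k) f y + b * (T ^^ k) g y) x
      = a * T ((T ^^ k) f) x + b * T ((T ^^ k) g) x"
    using assms by (intro T_linear iter_closed)
  ultimately show ?case
    by eventually_elim simp
qed simp

lemma iter_bounded:
  assumes "f \<in> borel_measurable M" "AE x in M. \<bar>f x\<bar> \<le> B" "0 \<le> B"
  shows "AE x in M. \<bar>(T ^^ k) f x\<bar> \<le> B"
proof (induction k)
  case (Suc k)
  have "(T ^^ k) f \<in> V"
    using assms by (intro iter_closed bounded_in_L1_plus_Linf)
  then show ?case
    using Suc assms(3) T_bounded[of "(T ^^ k) f" B] by (auto dest: L1_plus_Linf_measurable)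
qed (use assms in simp)

lemma average_measurable:
  "f \<in> V \<Longrightarrow> ergodic_average T n f \<in> borel_measurable M"
  unfolding ergodic_average_def using iter_closed[of f]
  by (intro borel_measurable_times borel_measurable_sum)
    (auto dest: L1_plus_Linf_measurable)

lemma average_add:
  assumes "f \<in> V" "g \<in> V"
  shows "AE x in M. \<forall>n. ergodic_average T n (\<lambda>y. f y + g y) x
      = ergodic_average T n f x + ergodic_average T n g x"
proof -
  have "AE x in M. \<forall>k. (T ^^ k) (\<lambda>y. f y + g y) x = (T ^^ k) f x + (T ^^ k) g x"
    unfolding AE_all_countable using iter_linear[OF assms, where a = 1 and b = 1] by simp
  then show ?thesis
    by eventually_elim (simp add: ergodic_average_def sum.distrib distrib_left)
qed

end

section \<open>The maximal inequality\<close>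

context dunford_schwartz_operator
begin

text \<open>Chacon's filling scheme: at every stage the pair consists of the signed mass above each
  point and the capacity left there; the point absorbs as much of the mass as the capacity
  permits, and the operator moves what remains. For a signed mass the absorbed part is
  collinear with the mass, so the moduli of the absorbed and the remaining part add up to that of the
  mass, as they would for a positive mass.\<close>

primrec fill :: "real \<Rightarrow> ('a \<Rightarrow> real) \<Rightarrow> nat \<Rightarrow> ('a \<Rightarrow> real) \<times> ('a \<Rightarrow> real)" where
  "fill a f 0 = (f, \<lambda>x. a)"
| "fill a f (Suc k) =
    (T (\<lambda>x. fst (fill a f k) x - clip (snd (fill a f k) x) (fst (fill a f k) x)),
     \<lambda>x. snd (fill a f k) x - \<bar>clip (snd (fill a f k) x) (fst (fill a f k) x)\<bar>)"

definition mass :: "real \<Rightarrow> ('a \<Rightarrow> real) \<Rightarrow> nat \<Rightarrow> 'a \<Rightarrow> real" where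
  "mass a f k = fst (fill a f k)"

definition capacity :: "real \<Rightarrow> ('a \<Rightarrow> real) \<Rightarrow> nat \<Rightarrow> 'a \<Rightarrow> real" where
  "capacity a f k = snd (fill a f k)"

definition absorbed :: "real \<Rightarrow> ('a \<Rightarrow> real) \<Rightarrow> nat \<Rightarrow> 'a \<Rightarrow> real" where
  "absorbed a f k x = clip (capacity a f k x) (mass a f k x)"

definition remaining :: "real \<Rightarrow> ('a \<Rightarrow> real) \<Rightarrow> nat \<Rightarrow> 'a \<Rightarrow> real" where
  "remaining a f k x = mass a f k x - absorbed a f k x"

lemma mass_0: "mass a f 0 = f"
  by (simp add: mass_def)

lemma mass_Suc: "mass a f (Suc k) = T (remaining a f k)"
  by (simp add: mass_def remaining_def [abs_def] absorbed_def capacity_def)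

lemma capacity_0: "capacity a f 0 x = a"
  by (simp add: capacity_def)

lemma capacity_Suc: "capacity a f (Suc k) x = capacity a f k x - \<bar>absorbed a f k x\<bar>"
  by (simp add: mass_def absorbed_def capacity_def)

lemma mass_split: "mass a f k x = absorbed a f k x + remaining a f k x"
  by (simp add: remaining_def)

lemma capacity_nonneg: "0 \<le> a \<Longrightarrow> 0 \<le> capacity a f k x"
proof (induction k)
  case (Suc k)
  then have "\<bar>absorbed a f k x\<bar> \<le> capacity a f k x"
    unfolding absorbed_def by (intro abs_clip_le) simp
  then show ?case by (simp add: capacity_Suc)
qed (simp add: capacity_0)

lemma capacity_decreasing: "k \<le> n \<Longrightarrow> capacity a f n x \<le> capacity a f k x"
  by (induction rule: dec_induct) (auto simp: capacity_Suc)

lemma sum_absorbed: "(\<Sum>k<n. \<bar>absorbed a f k x\<bar>) = a - capacity a f n x"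
  by (induction n) (auto simp: capacity_0 capacity_Suc)

lemma abs_mass: "0 \<le> a \<Longrightarrow> \<bar>mass a f k x\<bar> = \<bar>absorbed a f k x\<bar> + \<bar>remaining a f k x\<bar>"
  unfolding remaining_def absorbed_def
  by (rule abs_clip_add_abs_diff_clip [symmetric]) (rule capacity_nonneg)

lemma capacity_exhausted:
  assumes "0 \<le> a" "remaining a f k x \<noteq> 0" "k < n"
  shows "capacity a f n x = 0"
proof -
  have "\<bar>absorbed a f k x\<bar> = capacity a f k x"
    using assms(2) capacity_nonneg[OF assms(1)] unfolding remaining_def absorbed_def
    by (intro abs_clip_eq) auto
  then have "capacity a f (Suc k) x = 0"
    by (simp add: capacity_Suc)
  then show ?thesis
    using capacity_decreasing[of "Suc k" n a f x] capacity_nonneg[OF assms(1), of f n x] assms(3)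
    by simp
qed

lemma fill_measurable:
  assumes "f \<in> V" "0 \<le> a"
  shows "mass a f k \<in> V \<and> capacity a f k \<in> borel_measurable M"
proof (induction k)
  case 0
  then show ?case
    using assms by (simp add: mass_0 capacity_0 [abs_def])
next
  case (Suc k)
  have [measurable]: "mass a f k \<in> borel_measurable M" "capacity a f k \<in> borel_measurable M"
    using Suc by (auto dest: L1_plus_Linf_measurable)
  have [measurable]: "absorbed a f k \<in> borel_measurable M"
    unfolding absorbed_def [abs_def] by measurable
  have "\<bar>absorbed a f k x\<bar> \<le> a" for x
    using capacity_nonneg[OF assms(2), of f k x] capacity_decreasing[of 0 k a f x]
      abs_clip_le[of "capacity a f k x"]
    by (auto simp: absorbed_def capacity_0 intro: order_trans)
  then have "absorbed a f k \<in> V"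
    using assms(2) by (intro bounded_in_L1_plus_Linf) auto
  then have "remaining a f k \<in> V"
    unfolding remaining_def [abs_def] using Suc by (intro L1_plus_Linf_diff) auto
  then have "mass a f (Suc k) \<in> V"
    by (simp add: mass_Suc T_closed)
  moreover have "capacity a f (Suc k) \<in> borel_measurable M"
    by (simp add: capacity_Suc [abs_def])
  ultimately show ?case ..
qed

lemma mass_closed: "f \<in> V \<Longrightarrow> 0 \<le> a \<Longrightarrow> mass a f k \<in> V"
  using fill_measurable by blast

lemma capacity_measurable: "f \<in> V \<Longrightarrow> 0 \<le> a \<Longrightarrow> capacity a f k \<in> borel_measurable M"
  using fill_measurable by blast

lemma absorbed_bounds: "0 \<le> a \<Longrightarrow> \<bar>\<Sum>k<n. absorbed a f k x\<bar> \<le> a"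
  using sum_abs[of "\<lambda>k. absorbed a f k x" "{..<n}"] capacity_nonneg[of a f n x]
  by (simp add: sum_absorbed)

lemma absorbed_measurable:
  assumes "f \<in> V" "0 \<le> a"
  shows "absorbed a f k \<in> borel_measurable M"
proof -
  have [measurable]: "mass a f k \<in> borel_measurable M" "capacity a f k \<in> borel_measurable M"
    using assms mass_closed[of f a k] capacity_measurable[of f a k]
    by (auto dest: L1_plus_Linf_measurable)
  show ?thesis
    unfolding absorbed_def [abs_def] by measurable
qed

lemma absorbed_sum_closed:
  assumes "f \<in> V" "0 \<le> a"
  shows "(\<lambda>x. \<Sum>k<n. absorbed a f k x) \<in> V"
proof (rule bounded_in_L1_plus_Linf)
  show "AE x in M. \<bar>\<Sum>k<n. absorbed a f k x\<bar> \<le> a"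
    using absorbed_bounds[OF assms(2)] by simp
  show "(\<lambda>x. \<Sum>k<n. absorbed a f k x) \<in> borel_measurable M"
    by (intro borel_measurable_sum absorbed_measurable assms)
qed (rule assms)

lemma absorbed_closed:
  assumes "f \<in> V" "0 \<le> a"
  shows "absorbed a f k \<in> V"
  using L1_plus_Linf_diff[OF absorbed_sum_closed[OF assms, of "Suc k"]
      absorbed_sum_closed[OF assms, of k]] by simp

lemma remaining_closed:
  "f \<in> V \<Longrightarrow> 0 \<le> a \<Longrightarrow> remaining a f k \<in> V"
  unfolding remaining_def [abs_def]
  by (intro L1_plus_Linf_diff absorbed_closed mass_closed)

text \<open>The operator does not increase the total mass, so everything that is ever absorbed was
  present at the start.\<close>

lemma total_absorbed_le:
  assumes f: "f \<in> V" and a: "0 \<le> a"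
  shows "(\<integral>\<^sup>+ x. ennreal (a - capacity a f n x) \<partial>M) \<le> excess M 0 f"
proof -
  note [measurable] = absorbed_measurable[OF f a] capacity_measurable[OF f a]
  have [measurable]: "remaining a f k \<in> borel_measurable M" for k
    using remaining_closed[OF f a, of k] by measurable
  have "(\<integral>\<^sup>+ x. ennreal (a - capacity a f n x) \<partial>M) + excess M 0 (mass a f n) \<le> excess M 0 f"
  proof (induction n)
    case 0
    then show ?case by (simp add: capacity_0 mass_0)
  next
    case (Suc n)
    have *: "ennreal (a - capacity a f (Suc n) x)
        = ennreal (a - capacity a f n x) + ennreal \<bar>absorbed a f n x\<bar>" for x
      using capacity_decreasing[of 0 n a f x]
      by (simp add: capacity_Suc capacity_0 ennreal_plus [symmetric] algebra_simps
          del: ennreal_plus)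
    have "(\<integral>\<^sup>+ x. ennreal (a - capacity a f (Suc n) x) \<partial>M) + excess M 0 (mass a f (Suc n))
        = (\<integral>\<^sup>+ x. ennreal (a - capacity a f n x) \<partial>M) + excess M 0 (absorbed a f n)
          + excess M 0 (T (remaining a f n))"
      unfolding * by (simp add: nn_integral_add excess_def mass_Suc)
    also have "\<dots> \<le> (\<integral>\<^sup>+ x. ennreal (a - capacity a f n x) \<partial>M) + excess M 0 (absorbed a f n)
          + excess M 0 (remaining a f n)"
      by (intro add_left_mono T_excess_le remaining_closed f a) simp
    also have "\<dots> = (\<integral>\<^sup>+ x. ennreal (a - capacity a f n x) \<partial>M) + excess M 0 (mass a f n)"
      unfolding excess_def abs_mass[OF a]
      by (simp add: nn_integral_add ennreal_plus add.assoc)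
    also have "\<dots> \<le> excess M 0 f" by (rule Suc)
    finally show ?case .
  qed
  then show ?thesis
    by (rule order_trans[rotated]) (simp add: add_increasing2)
qed

lemma orbit_sum_Suc:
  assumes "f \<in> V"
  shows "AE x in M. (\<Sum>k<Suc n. (T ^^ k) f x) = f x + T (\<lambda>y. \<Sum>k<n. (T ^^ k) f y) x"
proof -
  have "AE x in M. T (\<lambda>y. \<Sum>k<n. (T ^^ k) f y) x = (\<Sum>k<n. T ((T ^^ k) f) x)"
    using assms by (intro T_sum iter_closed)
  then show ?thesis
    by eventually_elim (simp add: sum.lessThan_Suc_shift del: sum.lessThan_Suc)
qed

text \<open>Each of the first \<open>n\<close> iterates of \<open>f\<close> is a superposition of images of absorbed
  parts and one remaining part. Collecting images under the same power of the operator, the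
  absorbed parts add up to a function bounded by \<open>a\<close>.\<close>

lemma orbit_sum_decomposition:
  assumes f: "f \<in> V" and a: "0 \<le> a"
  shows "\<exists>b\<in>V. (AE x in M. \<bar>b x\<bar> \<le> real n * a) \<and>
    (AE x in M. (\<Sum>k<n. (T ^^ k) f x) = b x + (\<Sum>k<n. remaining a f k x))"
proof (induction n)
  case 0
  show ?case
    by (intro bexI[of _ "\<lambda>x. 0"]) (auto intro: L1_plus_Linf_zero)
next
  case (Suc n)
  then obtain b where b: "b \<in> V" and b_le: "AE x in M. \<bar>b x\<bar> \<le> real n * a"
    and b_eq: "AE x in M. (\<Sum>k<n. (T ^^ k) f x) = b x + (\<Sum>k<n. remaining a f k x)"
    by auto
  define b' where "b' x = T b x + (\<Sum>k<Suc n. absorbed a f k x)" for x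
  have Tb_le: "AE x in M. \<bar>T b x\<bar> \<le> real n * a"
    using b b_le a by (intro T_bounded) (auto dest: L1_plus_Linf_measurable)
  have rV: "remaining a f k \<in> V" for k
    by (rule remaining_closed[OF f a])
  have "b' \<in> V"
    unfolding b'_def [abs_def]
    by (intro L1_plus_Linf_add T_closed b absorbed_sum_closed f a)
  moreover have "AE x in M. \<bar>b' x\<bar> \<le> real (Suc n) * a"
    using Tb_le
  proof eventually_elim
    case (elim x)
    then show ?case
      using absorbed_bounds[OF a, of f x "Suc n"] unfolding b'_def
      by (simp add: algebra_simps del: sum.lessThan_Suc)
  qed
  moreover have "AE x in M. (\<Sum>k<Suc n. (T ^^ k) f x) = b' x + (\<Sum>k<Suc n. remaining a f k x)"
  proof -
    have 1: "AE x in M. T (\<lambda>y. \<Sum>k<n. (T ^^ k) f y) x = T (\<lambda>y. b y + (\<Sum>k<n. remaining a f k y)) x"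
      using b_eq by (intro T_cong L1_plus_Linf_sum L1_plus_Linf_add iter_closed f b rV)
    have 2: "AE x in M. T (\<lambda>y. b y + (\<Sum>k<n. remaining a f k y)) x
        = T b x + T (\<lambda>y. \<Sum>k<n. remaining a f k y) x"
      by (intro T_add L1_plus_Linf_sum b rV)
    have 3: "AE x in M. T (\<lambda>y. \<Sum>k<n. remaining a f k y) x = (\<Sum>k<n. T (remaining a f k) x)"
      by (intro T_sum rV)
    have 4: "f x + (\<Sum>k<n. T (remaining a f k) x)
        = (\<Sum>k<Suc n. absorbed a f k x) + (\<Sum>k<Suc n. remaining a f k x)" for x
    proof -
      have "f x + (\<Sum>k<n. T (remaining a f k) x) = (\<Sum>k<Suc n. mass a f k x)"
        by (simp add: sum.lessThan_Suc_shift mass_0 mass_Suc del: sum.lessThan_Suc)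
      also have "\<dots> = (\<Sum>k<Suc n. absorbed a f k x) + (\<Sum>k<Suc n. remaining a f k x)"
        by (simp only: mass_split sum.distrib)
      finally show ?thesis .
    qed
    show ?thesis
      using orbit_sum_Suc[OF f, of n] 1 2 3
    proof eventually_elim
      case (elim x)
      then show ?case
        using 4[of x] by (simp add: b'_def del: sum.lessThan_Suc)
    qed
  qed
  ultimately show ?case by auto
qed

text \<open>Where some average exceeds \<open>a\<close>, a remaining part must be nonzero, hence the capacity
  \<open>a\<close> has been used up; the measure of the set where this happens is limited by the mass
  available.\<close>

lemma maximal_inequality_L1:
  assumes f: "f \<in> V" and a: "0 < a"
  shows "ennreal a * emeasure M {x \<in> space M. \<exists>n. \<bar>ergodic_average T n f x\<bar> > a} \<le> excess M 0 f"
proof -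
  have a0: "0 \<le> a" using a by simp
  note [measurable] = capacity_measurable[OF f a0] average_measurable[OF f]
  define Z where "Z n = {x \<in> space M. capacity a f n x = 0}" for n
  have [measurable]: "Z n \<in> sets M" for n
    unfolding Z_def by measurable
  have mono: "incseq Z"
  proof (rule incseq_SucI)
    show "Z n \<subseteq> Z (Suc n)" for n
    proof
      fix x assume "x \<in> Z n"
      then show "x \<in> Z (Suc n)"
        using capacity_decreasing[of n "Suc n" a f x] capacity_nonneg[OF a0, of f "Suc n" x]
        by (simp add: Z_def)
    qed
  qed
  have bound: "ennreal a * emeasure M (Z n) \<le> excess M 0 f" for n
  proof -
    have "ennreal a * emeasure M (Z n) = (\<integral>\<^sup>+ x. ennreal a * indicator (Z n) x \<partial>M)"
      by (simp add: nn_integral_cmult_indicator)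
    also have "\<dots> \<le> (\<integral>\<^sup>+ x. ennreal (a - capacity a f n x) \<partial>M)"
      by (intro nn_integral_mono) (auto simp: Z_def indicator_def)
    also have "\<dots> \<le> excess M 0 f"
      by (rule total_absorbed_le[OF f a0])
    finally show ?thesis .
  qed
  have "AE x in M. \<forall>n. \<bar>ergodic_average T n f x\<bar> > a \<longrightarrow> x \<in> Z n"
    unfolding AE_all_countable
  proof
    fix n
    obtain b where "AE x in M. \<bar>b x\<bar> \<le> real n * a"
      "AE x in M. (\<Sum>k<n. (T ^^ k) f x) = b x + (\<Sum>k<n. remaining a f k x)"
      using orbit_sum_decomposition[OF f a0, of n] by blast
    then show "AE x in M. \<bar>ergodic_average T n f x\<bar> > a \<longrightarrow> x \<in> Z n"
      using AE_space
    proof eventually_elim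
      case (elim x)
      show ?case
      proof
        assume big: "\<bar>ergodic_average T n f x\<bar> > a"
        then have n: "0 < n"
          using a by (auto simp: ergodic_average_def intro: gr0I)
        \<comment> \<open>The bounded part of the decomposition is too small to account for this.\<close>
        have "\<bar>\<Sum>k<n. (T ^^ k) f x\<bar> > real n * a"
          using big n by (simp add: ergodic_average_def abs_mult field_simps)
        then have "(\<Sum>k<n. remaining a f k x) \<noteq> 0"
          using elim by auto
        then obtain k where "k < n" "remaining a f k x \<noteq> 0"
          by (metis sum.neutral lessThan_iff)
        then show "x \<in> Z n"
          using capacity_exhausted[OF a0, of f k x n] elim by (simp add: Z_def)
      qed
    qed
  qed
  then have "emeasure M {x \<in> space M. \<exists>n. \<bar>ergodic_average T n f x\<bar> > a} \<le> emeasure M (\<Union>n. Z n)"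
    by (intro emeasure_mono_AE) auto
  also have "\<dots> = (SUP n. emeasure M (Z n))"
    by (rule SUP_emeasure_incseq[symmetric]) (auto simp: mono)
  finally have "ennreal a * emeasure M {x \<in> space M. \<exists>n. \<bar>ergodic_average T n f x\<bar> > a}
      \<le> ennreal a * (SUP n. emeasure M (Z n))"
    by (rule mult_left_mono) simp
  also have "\<dots> = (SUP n. ennreal a * emeasure M (Z n))"
    by (rule SUP_mult_left_ennreal)
  also have "\<dots> \<le> excess M 0 f"
    using bound by (rule SUP_least)
  finally show ?thesis .
qed

text \<open>The part of \<open>f\<close> below height \<open>a\<close> contributes at most \<open>a\<close> to every average, so
  only the excess matters. In this form the inequality serves $L^1$, $L^2$ and uniformly small
  functions at once.\<close>

lemma maximal_inequality:
  assumes f: "f \<in> V" and a: "0 < a"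
  shows "ennreal a * emeasure M {x \<in> space M. \<exists>n. \<bar>ergodic_average T n f x\<bar> > 2 * a}
    \<le> excess M a f"
proof -
  have [measurable]: "f \<in> borel_measurable M" using f by measurable
  define c where "c x = clip a (f x)" for x
  define r where "r x = f x - c x" for x
  have c_le: "AE x in M. \<bar>c x\<bar> \<le> a"
    using a by (simp add: c_def abs_clip_le)
  have [measurable]: "c \<in> borel_measurable M" unfolding c_def by measurable
  have cV: "c \<in> V"
    using c_le a by (intro bounded_in_L1_plus_Linf) auto
  have rV: "r \<in> V"
    unfolding r_def [abs_def] by (intro L1_plus_Linf_diff f cV)
  note [measurable] = average_measurable[OF f] average_measurable[OF rV]
  have "AE x in M. \<forall>k. \<bar>(T ^^ k) c x\<bar> \<le> a"
    unfolding AE_all_countable using c_le a iter_bounded[of c a] by auto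
  then have c_avg: "AE x in M. \<forall>n. \<bar>ergodic_average T n c x\<bar> \<le> a"
  proof eventually_elim
    case (elim x)
    show ?case
    proof
      fix n
      have "\<bar>\<Sum>k<n. (T ^^ k) c x\<bar> \<le> (\<Sum>k<n. \<bar>(T ^^ k) c x\<bar>)" by (rule sum_abs)
      also have "\<dots> \<le> real n * a"
        using sum_mono[of "{..<n}" "\<lambda>k. \<bar>(T ^^ k) c x\<bar>" "\<lambda>k. a"] elim by simp
      finally show "\<bar>ergodic_average T n c x\<bar> \<le> a"
        using a by (cases "n = 0") (auto simp: ergodic_average_def abs_mult field_simps)
    qed
  qed
  have "AE x in M. \<forall>n. ergodic_average T n (\<lambda>y. c y + r y) x
      = ergodic_average T n c x + ergodic_average T n r x"
    by (rule average_add[OF cV rV])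
  then have "AE x in M. (\<exists>n. \<bar>ergodic_average T n f x\<bar> > 2 * a)
      \<longrightarrow> (\<exists>n. \<bar>ergodic_average T n r x\<bar> > a)"
    using c_avg
  proof eventually_elim
    case (elim x)
    show ?case
    proof (intro impI, elim exE)
      fix n assume "\<bar>ergodic_average T n f x\<bar> > 2 * a"
      moreover have "ergodic_average T n f x = ergodic_average T n c x + ergodic_average T n r x"
        using elim(1) by (simp add: r_def)
      moreover have "\<bar>ergodic_average T n c x\<bar> \<le> a" using elim(2) by simp
      ultimately show "\<exists>n. \<bar>ergodic_average T n r x\<bar> > a"
        by (intro exI[of _ n]) linarith
    qed
  qed
  then have "emeasure M {x \<in> space M. \<exists>n. \<bar>ergodic_average T n f x\<bar> > 2 * a}
      \<le> emeasure M {x \<in> space M. \<exists>n. \<bar>ergodic_average T n r x\<bar> > a}"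
    by (intro emeasure_mono_AE) auto
  then have "ennreal a * emeasure M {x \<in> space M. \<exists>n. \<bar>ergodic_average T n f x\<bar> > 2 * a}
      \<le> ennreal a * emeasure M {x \<in> space M. \<exists>n. \<bar>ergodic_average T n r x\<bar> > a}"
    by (rule mult_left_mono) simp
  also have "\<dots> \<le> excess M 0 r"
    by (rule maximal_inequality_L1[OF rV a])
  also have "excess M 0 r = excess M a f"
    unfolding excess_def r_def c_def using a
    by (intro nn_integral_cong) (auto simp: abs_diff_clip max_def ennreal_neg)
  finally show ?thesis .
qed

text \<open>By the maximal inequality the averages of \<open>f\<close> stay within \<open>2 * a\<close> of convergent
  ones off a set of measure at most \<open>\<delta> / a\<close>. Letting \<open>\<delta>\<close> tend to zero and then
  \<open>a\<close>, they form Cauchy sequences almost everywhere.\<close>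

lemma banach_principle:
  assumes f: "f \<in> V"
    and approx: "\<And>a \<delta>. 0 < a \<Longrightarrow> 0 < \<delta> \<Longrightarrow> \<exists>b\<in>V.
      (AE x in M. convergent (\<lambda>n. ergodic_average T n b x)) \<and>
      excess M a (\<lambda>x. f x - b x) \<le> ennreal \<delta>"
  shows "AE x in M. convergent (\<lambda>n. ergodic_average T n f x)"
proof -
  have osc: "AE x in M. \<exists>N. \<forall>m\<ge>N. \<forall>n\<ge>N.
      \<bar>ergodic_average T m f x - ergodic_average T n f x\<bar> \<le> 5 * a" if a: "0 < a" for a
  proof -
    \<comment> \<open>The factor \<open>a\<close> turns the bounds on the excess into bounds \<open>1 / Suc i\<close> on measures.\<close>
    have "\<forall>i. \<exists>b. b \<in> V \<and> (AE x in M. convergent (\<lambda>n. ergodic_average T n b x)) \<and>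
        excess M a (\<lambda>x. f x - b x) \<le> ennreal (a / real (Suc i))"
      using a approx by (meson divide_pos_pos of_nat_0_less_iff zero_less_Suc)
    then obtain b where bV: "\<And>i. b i \<in> V"
      and b_conv: "\<And>i. AE x in M. convergent (\<lambda>n. ergodic_average T n (b i) x)"
      and b_close: "\<And>i. excess M a (\<lambda>x. f x - b i x) \<le> ennreal (a / real (Suc i))"
      by metis
    have dV: "(\<lambda>x. f x - b i x) \<in> V" for i
      by (intro L1_plus_Linf_diff f bV)
    note [measurable] = average_measurable[OF dV]
    define S where "S i = {x \<in> space M. \<exists>n. \<bar>ergodic_average T n (\<lambda>y. f y - b i y) x\<bar> > 2 * a}" for i
    have [measurable]: "S i \<in> sets M" for i unfolding S_def by measurable
    have S_le: "emeasure M (S i) \<le> ennreal (1 / real (Suc i))" for i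
    proof -
      have "ennreal a * emeasure M (S i) \<le> ennreal (a / real (Suc i))"
        unfolding S_def using maximal_inequality[OF dV a] b_close by (rule order_trans)
      also have "\<dots> = ennreal a * ennreal (1 / real (Suc i))"
        using a by (simp add: ennreal_mult' [symmetric])
      finally show ?thesis
        using a by (subst (asm) ennreal_mult_le_mult_iff) auto
    qed
    have "emeasure M (\<Inter>i. S i) = 0"
    proof -
      have "emeasure M (\<Inter>i. S i) \<le> ennreal (1 / real (Suc i))" for i
        using S_le[of i] emeasure_mono[of "\<Inter>i. S i" "S i" M] by (auto intro: order_trans)
      moreover have "(\<lambda>i. ennreal (1 / real (Suc i))) \<longlonglongrightarrow> ennreal 0"
        by (intro tendsto_ennrealI LIMSEQ_Suc lim_1_over_n)
      ultimately have "emeasure M (\<Inter>i. S i) \<le> ennreal 0"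
        by (intro LIMSEQ_le_const) auto
      then show ?thesis by simp
    qed
    then have "AE x in M. x \<notin> (\<Inter>i. S i)"
      by (intro AE_not_in null_setsI) auto
    moreover have "AE x in M. \<forall>i. convergent (\<lambda>n. ergodic_average T n (b i) x)"
      unfolding AE_all_countable using b_conv by auto
    moreover have "AE x in M. \<forall>i n. ergodic_average T n (\<lambda>y. b i y + (f y - b i y)) x
        = ergodic_average T n (b i) x + ergodic_average T n (\<lambda>y. f y - b i y) x"
      unfolding AE_all_countable[where P = "\<lambda>i x. \<forall>n. _ i n x"]
      by (intro allI average_add bV dV)
    ultimately show ?thesis
      using AE_space
    proof eventually_elim
      case (elim x)
      then obtain i where i: "\<And>n. \<bar>ergodic_average T n (\<lambda>y. f y - b i y) x\<bar> \<le> 2 * a"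
        by (auto simp: S_def not_less)
      have "Cauchy (\<lambda>n. ergodic_average T n (b i) x)"
        using elim(2) by (simp add: Cauchy_convergent_iff)
      then obtain N where N: "\<And>m n. N \<le> m \<Longrightarrow> N \<le> n \<Longrightarrow>
          \<bar>ergodic_average T m (b i) x - ergodic_average T n (b i) x\<bar> < a"
        using a unfolding Cauchy_def dist_real_def by meson
      have split: "ergodic_average T n f x
          = ergodic_average T n (b i) x + ergodic_average T n (\<lambda>y. f y - b i y) x" for n
        using elim(3) by simp
      have "\<bar>ergodic_average T m f x - ergodic_average T n f x\<bar> \<le> 5 * a" if "N \<le> m" "N \<le> n" for m n
        using N[OF that] i[of m] i[of n] unfolding split[of m] split[of n] by linarith
      then show ?case by blast
    qed
  qed
  have "AE x in M. \<forall>j. \<exists>N. \<forall>m\<ge>N. \<forall>n\<ge>N.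
      \<bar>ergodic_average T m f x - ergodic_average T n f x\<bar> \<le> 5 * (1 / real (Suc j))"
    unfolding AE_all_countable by (intro allI osc) simp
  then show ?thesis
  proof eventually_elim
    case (elim x)
    have "Cauchy (\<lambda>n. ergodic_average T n f x)"
    proof (rule metric_CauchyI)
      fix e :: real assume "0 < e"
      then obtain j where "inverse (real (Suc j)) < e / 5"
        using reals_Archimedean[of "e / 5"] by auto
      then have j: "5 * (1 / real (Suc j)) < e" by (simp add: inverse_eq_divide)
      show "\<exists>N. \<forall>m\<ge>N. \<forall>n\<ge>N. dist (ergodic_average T m f x) (ergodic_average T n f x) < e"
        using elim[rule_format, of j] j unfolding dist_real_def by (meson le_less_trans)
    qed
    then show ?case by (simp add: Cauchy_convergent_iff)
  qed
qed

end

section \<open>Square integrable functions\<close>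

definition square_integrable :: "'a measure \<Rightarrow> ('a \<Rightarrow> real) set" where
  "square_integrable M = {f \<in> borel_measurable M. integrable M (\<lambda>x. (f x)\<^sup>2)}"

definition energy :: "'a measure \<Rightarrow> ('a \<Rightarrow> real) \<Rightarrow> real" where
  "energy M f = (LINT x|M. (f x)\<^sup>2)"

lemma square_integrable_measurable [measurable_dest]:
  "f \<in> square_integrable M \<Longrightarrow> f \<in> borel_measurable M"
  by (simp add: square_integrable_def)

lemma energy_nonneg: "0 \<le> energy M f"
  by (simp add: energy_def)

lemma square_integrable_iff_nn:
  assumes [measurable]: "f \<in> borel_measurable M"
  shows "f \<in> square_integrable M \<longleftrightarrow> (\<integral>\<^sup>+ x. ennreal ((f x)\<^sup>2) \<partial>M) < \<infinity>"
  by (simp add: square_integrable_def integrable_iff_bounded)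

lemma nn_integral_square:
  "f \<in> square_integrable M \<Longrightarrow> (\<integral>\<^sup>+ x. ennreal ((f x)\<^sup>2) \<partial>M) = ennreal (energy M f)"
  unfolding square_integrable_def energy_def by (intro nn_integral_eq_integral) auto

lemma square_le_double: "(x + y)\<^sup>2 \<le> 2 * x\<^sup>2 + 2 * (y::real)\<^sup>2"
  using zero_le_power2[of "x - y"] by (simp add: power2_eq_square algebra_simps)

lemma square_integrable_scale:
  "f \<in> square_integrable M \<Longrightarrow> (\<lambda>x. c * f x) \<in> square_integrable M"
  by (auto simp: square_integrable_def power_mult_distrib)

lemma square_integrable_add:
  assumes "f \<in> square_integrable M" "g \<in> square_integrable M"
  shows "(\<lambda>x. f x + g x) \<in> square_integrable M"
proof -
  have [measurable]: "f \<in> borel_measurable M" "g \<in> borel_measurable M"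
    using assms by measurable
  have "integrable M (\<lambda>x. 2 * (f x)\<^sup>2 + 2 * (g x)\<^sup>2)"
    using assms by (simp add: square_integrable_def)
  then have "integrable M (\<lambda>x. (f x + g x)\<^sup>2)"
    by (rule Bochner_Integration.integrable_bound) (auto simp: square_le_double)
  then show ?thesis by (simp add: square_integrable_def)
qed

lemma square_integrable_diff:
  assumes "f \<in> square_integrable M" "g \<in> square_integrable M"
  shows "(\<lambda>x. f x - g x) \<in> square_integrable M"
  using square_integrable_add[OF assms(1) square_integrable_scale[OF assms(2), of "-1"]] by simp

lemma energy_scale: "energy M (\<lambda>x. c * f x) = c\<^sup>2 * energy M f"
  by (simp add: energy_def power_mult_distrib)

lemma energy_parallelogram:
  assumes "f \<in> square_integrable M" "g \<in> square_integrable M"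
  shows "energy M (\<lambda>x. f x + g x) + energy M (\<lambda>x. f x - g x) = 2 * energy M f + 2 * energy M g"
proof -
  have "energy M (\<lambda>x. f x + g x) + energy M (\<lambda>x. f x - g x)
      = (LINT x|M. (f x + g x)\<^sup>2 + (f x - g x)\<^sup>2)"
    unfolding energy_def
    using square_integrable_add[OF assms] square_integrable_diff[OF assms]
    by (intro Bochner_Integration.integral_add[symmetric]) (auto simp: square_integrable_def)
  also have "\<dots> = (LINT x|M. 2 * (f x)\<^sup>2 + 2 * (g x)\<^sup>2)"
    by (intro Bochner_Integration.integral_cong) (auto simp: power2_eq_square algebra_simps)
  also have "\<dots> = 2 * energy M f + 2 * energy M g"
    using assms by (simp add: energy_def square_integrable_def)
  finally show ?thesis .
qed

lemma energy_add_le: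
  assumes "f \<in> square_integrable M" "g \<in> square_integrable M"
  shows "energy M (\<lambda>x. f x + g x) \<le> 2 * energy M f + 2 * energy M g"
  using energy_parallelogram[OF assms] energy_nonneg[of M "\<lambda>x. f x - g x"] by simp

lemma energy_cong_AE:
  assumes "f \<in> borel_measurable M" "g \<in> borel_measurable M" "AE x in M. f x = g x"
  shows "energy M f = energy M g"
  unfolding energy_def using assms by (intro integral_cong_AE) auto

lemma square_integrable_in_L1_plus_Linf:
  assumes "f \<in> square_integrable M"
  shows "f \<in> L1_plus_Linf M"
proof (rule finite_excess_in_L1_plus_Linf)
  show "excess M 1 f < \<infinity>"
  proof -
    have "\<bar>f x\<bar> - 1 \<le> (f x)\<^sup>2" for x
      using zero_le_power2[of "\<bar>f x\<bar> - 1"] by (simp add: power2_eq_square algebra_simps)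
    then have "excess M 1 f \<le> (\<integral>\<^sup>+ x. ennreal ((f x)\<^sup>2) \<partial>M)"
      unfolding excess_def by (intro nn_integral_mono ennreal_leI)
    then show ?thesis
      using nn_integral_square[OF assms] by (auto intro: le_less_trans)
  qed
qed (use assms in measurable)

lemma excess_le_energy:
  assumes f: "f \<in> square_integrable M" and a: "0 < a"
  shows "excess M a f \<le> ennreal (energy M f / a)"
proof -
  have [measurable]: "f \<in> borel_measurable M" using f by measurable
  have "\<bar>y\<bar> - a \<le> y\<^sup>2 / a" for y :: real
  proof -
    have "a * (\<bar>y\<bar> - a) \<le> y\<^sup>2"
    proof -
      have "y\<^sup>2 - a * (\<bar>y\<bar> - a) = (\<bar>y\<bar> - a / 2)\<^sup>2 + 3 / 4 * a\<^sup>2"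
        by (simp add: power2_eq_square algebra_simps)
      then show ?thesis
        using zero_le_power2[of "\<bar>y\<bar> - a / 2"] zero_le_power2[of a] by linarith
    qed
    then show ?thesis using a by (simp add: field_simps)
  qed
  then have "excess M a f \<le> (\<integral>\<^sup>+ x. ennreal (1 / a) * ennreal ((f x)\<^sup>2) \<partial>M)"
    unfolding excess_def using a
    by (intro nn_integral_mono) (simp add: ennreal_mult' [symmetric] ennreal_leI)
  also have "\<dots> = ennreal (1 / a) * ennreal (energy M f)"
    by (simp add: nn_integral_cmult nn_integral_square[OF f])
  also have "\<dots> = ennreal (energy M f / a)"
    using a energy_nonneg[of M f] by (simp add: ennreal_mult' [symmetric])
  finally show ?thesis .
qed

text \<open>The increments of a rapidly Cauchy sequence satisfy
  $\sum_j 4^j \int (h_{j+1} - h_j)^2 < \infty$, so almost everywhere they are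
  $O(2^{-j})$ and the sequence converges pointwise; Fatou's lemma turns this into convergence in
  mean square.\<close>

lemma square_integrable_complete:
  fixes h :: "nat \<Rightarrow> 'a \<Rightarrow> real"
  assumes h: "\<And>j. h j \<in> square_integrable M"
    and cauchy: "\<And>i j. j \<le> i \<Longrightarrow> energy M (\<lambda>x. h i x - h j x) \<le> C / 16 ^ j"
  shows "\<exists>p\<in>square_integrable M. \<forall>j. energy M (\<lambda>x. p x - h j x) \<le> C / 16 ^ j"
proof -
  have [measurable]: "h j \<in> borel_measurable M" for j using h by measurable
  have C0: "0 \<le> C"
    using cauchy[of 0 0] energy_nonneg[of M "\<lambda>x. h 0 x - h 0 x"] by simp
  have hd: "(\<lambda>x. h i x - h j x) \<in> square_integrable M" for i j
    by (intro square_integrable_diff h)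
  define u where "u j x = ennreal (4 ^ j * (h (Suc j) x - h j x)\<^sup>2)" for j x
  have [measurable]: "u j \<in> borel_measurable M" for j unfolding u_def by measurable
  have u_int: "(\<integral>\<^sup>+ x. u j x \<partial>M) \<le> ennreal (C * (1 / 4) ^ j)" for j
  proof -
    have "(\<integral>\<^sup>+ x. u j x \<partial>M) = ennreal (4 ^ j) * ennreal (energy M (\<lambda>x. h (Suc j) x - h j x))"
      unfolding u_def by (simp add: ennreal_mult' nn_integral_cmult nn_integral_square[OF hd])
    also have "\<dots> \<le> ennreal (4 ^ j) * ennreal (C / 16 ^ j)"
      using cauchy[of j "Suc j"] by (intro mult_left_mono ennreal_leI) auto
    also have "\<dots> = ennreal (C * (1 / 4) ^ j)"
    proof -
      have "(16::real) ^ j = 4 ^ j * 4 ^ j"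
        by (simp add: power_mult_distrib [symmetric])
      then have "4 ^ j * (C / 16 ^ j) = C * (1 / 4) ^ j"
        by (simp add: power_divide)
      then show ?thesis by (simp add: ennreal_mult' [symmetric])
    qed
    finally show ?thesis .
  qed
  have "(\<integral>\<^sup>+ x. (\<Sum>j. u j x) \<partial>M) = (\<Sum>j. \<integral>\<^sup>+ x. u j x \<partial>M)"
    by (rule nn_integral_suminf) simp
  also have "\<dots> \<le> (\<Sum>j. ennreal (C * (1 / 4) ^ j))"
    by (intro suminf_le u_int) auto
  also have "\<dots> = ennreal (\<Sum>j. C * (1 / 4) ^ j)"
    using C0 by (intro suminf_ennreal2) (auto intro!: summable_mult summable_geometric)
  also have "\<dots> < \<infinity>" by simp
  finally have "AE x in M. (\<Sum>j. u j x) \<noteq> \<infinity>"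
    by (intro nn_integral_PInf_AE) auto
  then have conv: "AE x in M. convergent (\<lambda>j. h j x)"
  proof eventually_elim
    case (elim x)
    define D where "D = enn2real (\<Sum>j. u j x)"
    have D: "(\<Sum>j. u j x) = ennreal D" "0 \<le> D"
      using elim by (auto simp: D_def less_top)
    have step: "\<bar>h (Suc j) x - h j x\<bar> \<le> sqrt D * (1 / 2) ^ j" for j
    proof -
      have "u j x \<le> ennreal D"
        unfolding D(1) [symmetric] using sum_le_suminf[of "\<lambda>j. u j x" "{j}"] by simp
      then have "4 ^ j * (h (Suc j) x - h j x)\<^sup>2 \<le> D"
        using D(2) by (simp add: u_def)
      then have "(2 ^ j * \<bar>h (Suc j) x - h j x\<bar>)\<^sup>2 \<le> D"
        using power_mult [of "2::real" j 2] power_mult [of "2::real" 2 j]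
        by (simp add: power_mult_distrib mult.commute)
      then have "2 ^ j * \<bar>h (Suc j) x - h j x\<bar> \<le> sqrt D"
        by (rule real_le_rsqrt)
      then show ?thesis by (simp add: power_divide field_simps)
    qed
    have "summable (\<lambda>j. h (Suc j) x - h j x)"
      by (rule summable_comparison_test'[where g = "\<lambda>j. sqrt D * (1 / 2) ^ j" and N = 0])
        (use step in \<open>auto intro!: summable_mult summable_geometric\<close>)
    then have "convergent (\<lambda>n. \<Sum>j<n. h (Suc j) x - h j x)"
      by (simp add: summable_iff_convergent)
    then have "convergent (\<lambda>n. (h n x - h 0 x) + h 0 x)"
      unfolding sum_lessThan_telescope[of "\<lambda>j. h j x"]
      by (rule convergent_add) (rule convergent_const)
    then show ?case by simp
  qed
  define p where "p x = lim (\<lambda>j. h j x)" for x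
  have [measurable]: "p \<in> borel_measurable M"
    unfolding p_def [abs_def] by (rule borel_measurable_lim_metric) simp
  have close: "(\<integral>\<^sup>+ x. ennreal ((p x - h j x)\<^sup>2) \<partial>M) \<le> ennreal (C / 16 ^ j)" for j
  proof -
    have "(\<integral>\<^sup>+ x. ennreal ((p x - h j x)\<^sup>2) \<partial>M)
        = (\<integral>\<^sup>+ x. liminf (\<lambda>i. ennreal ((h i x - h j x)\<^sup>2)) \<partial>M)"
    proof (rule nn_integral_cong_AE, use conv in eventually_elim)
      case (elim x)
      then have "(\<lambda>i. h i x) \<longlonglongrightarrow> p x"
        by (simp add: p_def convergent_LIMSEQ_iff)
      then have "(\<lambda>i. ennreal ((h i x - h j x)\<^sup>2)) \<longlonglongrightarrow> ennreal ((p x - h j x)\<^sup>2)"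
        by (intro tendsto_ennrealI tendsto_intros)
      then show ?case
        by (intro lim_imp_Liminf [symmetric]) auto
    qed
    also have "\<dots> \<le> liminf (\<lambda>i. \<integral>\<^sup>+ x. ennreal ((h i x - h j x)\<^sup>2) \<partial>M)"
      by (intro nn_integral_liminf) simp
    also have "\<dots> \<le> liminf (\<lambda>i. ennreal (C / 16 ^ j))"
      by (intro Liminf_mono eventually_sequentiallyI[of j])
        (auto simp: nn_integral_square[OF hd] intro!: ennreal_leI cauchy)
    also have "\<dots> = ennreal (C / 16 ^ j)" by (simp add: Liminf_const)
    finally show ?thesis .
  qed
  have pd: "(\<lambda>x. p x - h j x) \<in> square_integrable M" for j
    using close[of j] by (subst square_integrable_iff_nn) (auto intro: le_less_trans)
  have "p \<in> square_integrable M"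
    using square_integrable_add[OF pd[of 0] h[of 0]] by simp
  moreover have "energy M (\<lambda>x. p x - h j x) \<le> C / 16 ^ j" for j
    using close[of j] C0 by (simp add: nn_integral_square[OF pd])
  ultimately show ?thesis by auto
qed

context dunford_schwartz_operator
begin

text \<open>Tonelli's theorem applied to $y^2 = 2 \int_0^\infty (|y| - a)^+ \, da$.\<close>

lemma nn_integral_square_layers:
  assumes [measurable]: "f \<in> borel_measurable M"
  shows "(\<integral>\<^sup>+ x. ennreal ((f x)\<^sup>2) \<partial>M)
    = 2 * (\<integral>\<^sup>+ a. excess M a f * indicator {0..} a \<partial>lborel)"
proof -
  interpret pair_sigma_finite M lborel ..
  have layer: "(\<integral>\<^sup>+ a. ennreal (\<bar>y\<bar> - a) * indicator {0..} a \<partial>lborel) = ennreal (y\<^sup>2 / 2)"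
    for y :: real
  proof -
    have "(\<integral>\<^sup>+ a. ennreal (\<bar>y\<bar> - a) * indicator {0..} a \<partial>lborel)
        = (\<integral>\<^sup>+ a. ennreal (\<bar>y\<bar> - a) * indicator {0..\<bar>y\<bar>} a \<partial>lborel)"
      by (intro nn_integral_cong) (auto simp: indicator_def ennreal_neg)
    also have "\<dots> = ennreal ((\<bar>y\<bar> * \<bar>y\<bar> - \<bar>y\<bar>\<^sup>2 / 2) - (\<bar>y\<bar> * 0 - 0\<^sup>2 / 2))"
      by (rule nn_integral_FTC_Icc) (auto intro!: derivative_eq_intros)
    also have "\<bar>y\<bar> * \<bar>y\<bar> - \<bar>y\<bar>\<^sup>2 / 2 - (\<bar>y\<bar> * 0 - 0\<^sup>2 / 2) = y\<^sup>2 / 2"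
      by (simp add: power2_eq_square)
    finally show ?thesis .
  qed
  have "(\<integral>\<^sup>+ a. excess M a f * indicator {0..} a \<partial>lborel)
      = (\<integral>\<^sup>+ a. (\<integral>\<^sup>+ x. ennreal (\<bar>f x\<bar> - a) * indicator {0..} a \<partial>M) \<partial>lborel)"
    unfolding excess_def by (intro nn_integral_cong) (simp add: nn_integral_multc)
  also have "\<dots> = (\<integral>\<^sup>+ x. (\<integral>\<^sup>+ a. ennreal (\<bar>f x\<bar> - a) * indicator {0..} a \<partial>lborel) \<partial>M)"
    by (rule Fubini') measurable
  also have "\<dots> = (\<integral>\<^sup>+ x. ennreal ((f x)\<^sup>2 / 2) \<partial>M)"
    by (simp add: layer)
  also have "2 * \<dots> = (\<integral>\<^sup>+ x. 2 * ennreal ((f x)\<^sup>2 / 2) \<partial>M)"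
    by (rule nn_integral_cmult [symmetric]) simp
  also have "\<dots> = (\<integral>\<^sup>+ x. ennreal ((f x)\<^sup>2) \<partial>M)"
  proof (intro nn_integral_cong)
    fix x
    have "2 * ennreal ((f x)\<^sup>2 / 2) = ennreal (2 * ((f x)\<^sup>2 / 2))"
      by (subst ennreal_mult') auto
    then show "2 * ennreal ((f x)\<^sup>2 / 2) = ennreal ((f x)\<^sup>2)" by simp
  qed
  finally show ?thesis by simp
qed

text \<open>The contraction of all excesses integrates over the height to a contraction in $L^2$.\<close>

lemma T_square_integrable:
  assumes f: "f \<in> square_integrable M"
  shows "T f \<in> square_integrable M" "energy M (T f) \<le> energy M f"
proof -
  have fV: "f \<in> V" by (rule square_integrable_in_L1_plus_Linf[OF f])
  have meas: "f \<in> borel_measurable M" "T f \<in> borel_measurable M"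
    using fV T_closed[OF fV] by measurable
  have "(\<integral>\<^sup>+ x. ennreal ((T f x)\<^sup>2) \<partial>M) \<le> (\<integral>\<^sup>+ x. ennreal ((f x)\<^sup>2) \<partial>M)"
    unfolding nn_integral_square_layers[OF meas(1)] nn_integral_square_layers[OF meas(2)]
    by (intro mult_left_mono nn_integral_mono) (auto simp: indicator_def T_excess_le[OF fV])
  also have "\<dots> = ennreal (energy M f)" by (rule nn_integral_square[OF f])
  finally have le: "(\<integral>\<^sup>+ x. ennreal ((T f x)\<^sup>2) \<partial>M) \<le> ennreal (energy M f)" .
  then show *: "T f \<in> square_integrable M"
    using meas(2) by (subst square_integrable_iff_nn) (auto intro: le_less_trans)
  show "energy M (T f) \<le> energy M f"
    using le energy_nonneg[of M f] by (simp add: nn_integral_square[OF *])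
qed

end

section \<open>Almost everywhere convergence\<close>

context dunford_schwartz_operator
begin

definition bounded_square_integrable :: "('a \<Rightarrow> real) set" where
  "bounded_square_integrable = {f \<in> square_integrable M. \<exists>B\<ge>0. AE x in M. \<bar>f x\<bar> \<le> B}"

lemma bounded_square_integrable_zero: "(\<lambda>x. 0) \<in> bounded_square_integrable"
  by (auto simp: bounded_square_integrable_def square_integrable_def)

lemma bounded_square_integrable_scale:
  assumes "f \<in> bounded_square_integrable"
  shows "(\<lambda>x. c * f x) \<in> bounded_square_integrable"
proof -
  obtain B where B: "0 \<le> B" "AE x in M. \<bar>f x\<bar> \<le> B"
    using assms by (auto simp: bounded_square_integrable_def)
  have "AE x in M. \<bar>c * f x\<bar> \<le> \<bar>c\<bar> * B"
    using B(2) by eventually_elim (simp add: abs_mult mult_left_mono)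
  then show ?thesis
    using assms B(1) square_integrable_scale
    by (auto simp: bounded_square_integrable_def intro!: exI[of _ "\<bar>c\<bar> * B"])
qed

lemma bounded_square_integrable_add:
  assumes "f \<in> bounded_square_integrable" "g \<in> bounded_square_integrable"
  shows "(\<lambda>x. f x + g x) \<in> bounded_square_integrable"
proof -
  obtain B C where B: "0 \<le> B" "AE x in M. \<bar>f x\<bar> \<le> B" and C: "0 \<le> C" "AE x in M. \<bar>g x\<bar> \<le> C"
    using assms by (auto simp: bounded_square_integrable_def)
  have "AE x in M. \<bar>f x + g x\<bar> \<le> B + C"
    using B(2) C(2) by eventually_elim linarith
  then show ?thesis
    using assms B(1) C(1) square_integrable_add
    by (auto simp: bounded_square_integrable_def intro!: exI[of _ "B + C"])
qed

lemma bounded_square_integrable_diff: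
  assumes "f \<in> bounded_square_integrable" "g \<in> bounded_square_integrable"
  shows "(\<lambda>x. f x - g x) \<in> bounded_square_integrable"
  using bounded_square_integrable_add[OF assms(1)
      bounded_square_integrable_scale[OF assms(2), of "-1"]] by simp

lemma bounded_square_integrable_T:
  assumes "f \<in> bounded_square_integrable"
  shows "T f \<in> bounded_square_integrable"
proof -
  obtain B where B: "0 \<le> B" "AE x in M. \<bar>f x\<bar> \<le> B"
    using assms by (auto simp: bounded_square_integrable_def)
  have "AE x in M. \<bar>T f x\<bar> \<le> B"
    using assms B
    by (intro T_bounded) (auto simp: bounded_square_integrable_def square_integrable_def)
  then show ?thesis
    using assms B(1) T_square_integrable(1)
    by (auto simp: bounded_square_integrable_def)
qed

text \<open>Modulo coboundaries \<open>g - T g\<close> of bounded functions, \<open>f\<close> is nearly invariant: a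
  sequence in the coset of \<open>f\<close> whose energy tends to the infimum is Cauchy by the
  parallelogram law, and since the operator preserves the coset and does not increase energy, the
  same law shows that the limit is fixed by the operator.\<close>

lemma mean_ergodic_decomposition:
  assumes f: "f \<in> bounded_square_integrable"
  shows "\<exists>p\<in>square_integrable M. (AE x in M. T p x = p x) \<and>
    (\<forall>\<epsilon>>0. \<exists>g\<in>bounded_square_integrable. energy M (\<lambda>x. p x - (f x - (g x - T g x))) \<le> \<epsilon>)"
proof -
  let ?D = "bounded_square_integrable"
  define H where "H g = (\<lambda>x. f x - (g x - T g x))" for g
  have HD: "H g \<in> ?D" if "g \<in> ?D" for g
    unfolding H_def using that f
    by (intro bounded_square_integrable_diff bounded_square_integrable_T)
  have D2: "h \<in> square_integrable M" if "h \<in> ?D" for h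
    using that by (simp add: bounded_square_integrable_def)
  have DV: "h \<in> V" if "h \<in> ?D" for h
    by (intro square_integrable_in_L1_plus_Linf D2 that)
  have H2: "H g \<in> square_integrable M" if "g \<in> ?D" for g
    by (intro D2 HD that)
  have TD: "T g \<in> ?D" if "g \<in> ?D" for g
    by (rule bounded_square_integrable_T[OF that])
  have meas: "h \<in> borel_measurable M" if "h \<in> square_integrable M" for h
    using that by measurable
  define d where "d = (INF g\<in>?D. energy M (H g))"
  have bdd: "bdd_below ((\<lambda>g. energy M (H g)) ` ?D)"
    by (rule bdd_belowI[of _ 0]) (auto simp: energy_nonneg)
  have d_le: "d \<le> energy M (H g)" if "g \<in> ?D" for g
    unfolding d_def by (rule cINF_lower[OF bdd that])
  have near: "\<exists>g\<in>?D. energy M (H g) < d + e" if "0 < e" for e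
  proof (rule ccontr)
    assume "\<not> (\<exists>g\<in>?D. energy M (H g) < d + e)"
    then have "d + e \<le> d"
      unfolding d_def using bounded_square_integrable_zero
      by (intro cINF_greatest) (auto simp: not_less)
    then show False using that by simp
  qed
  \<comment> \<open>Midpoints stay in the coset, so their energy is at least \<open>d\<close>.\<close>
  have half_sum: "4 * d \<le> energy M (\<lambda>x. H g x + H k x)" if gk: "g \<in> ?D" "k \<in> ?D" for g k
  proof -
    let ?m = "\<lambda>x. (1 / 2) * g x + (1 / 2) * k x"
    have mD: "?m \<in> ?D"
      by (intro bounded_square_integrable_add bounded_square_integrable_scale gk)
    have "AE x in M. T ?m x = (1 / 2) * T g x + (1 / 2) * T k x"
      by (intro T_linear DV gk)
    then have "AE x in M. H g x + H k x = 2 * H ?m x"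
      by eventually_elim (simp add: H_def algebra_simps)
    then have "energy M (\<lambda>x. H g x + H k x) = energy M (\<lambda>x. 2 * H ?m x)"
      by (intro energy_cong_AE meas square_integrable_add square_integrable_scale H2 gk mD)
    also have "\<dots> = 4 * energy M (H ?m)"
      by (simp add: energy_scale)
    finally show ?thesis using d_le[OF mD] by simp
  qed
  have gap: "energy M (\<lambda>x. H g x - H k x) \<le> 2 * (energy M (H g) - d) + 2 * (energy M (H k) - d)"
    if "g \<in> ?D" "k \<in> ?D" for g k
    using energy_parallelogram[OF H2[OF that(1)] H2[OF that(2)]] half_sum[OF that] by simp
  have drift: "energy M (\<lambda>x. H g x - T (H g) x) \<le> 4 * (energy M (H g) - d)" if g: "g \<in> ?D" for g
  proof -
    let ?k = "\<lambda>x. g x + H g x"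
    \<comment> \<open>Applying the operator to \<open>H g\<close> stays in the coset, adding \<open>H g\<close> to the transfer function.\<close>
    have kD: "?k \<in> ?D"
      by (intro bounded_square_integrable_add HD g)
    have "AE x in M. T ?k x = T g x + T (H g) x"
      by (intro T_add DV HD g)
    then have *: "AE x in M. T (H g) x = H ?k x"
      by eventually_elim (simp add: H_def)
    have "energy M (T (H g)) = energy M (H ?k)"
      by (intro energy_cong_AE meas T_square_integrable(1) H2 g kD *)
    then have "energy M (H ?k) \<le> energy M (H g)"
      using T_square_integrable(2)[OF H2[OF g]] by simp
    moreover have "energy M (\<lambda>x. H g x - T (H g) x) = energy M (\<lambda>x. H g x - H ?k x)"
      using * by (intro energy_cong_AE meas square_integrable_diff T_square_integrable(1) H2 g kD)
        (auto elim: eventually_mono)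
    ultimately show ?thesis using gap[OF g kD] by simp
  qed
  \<comment> \<open>The rate \<open>1 / 16 ^ j\<close> is the one required by the completeness lemma.\<close>
  have "\<forall>j. \<exists>g. g \<in> ?D \<and> energy M (H g) < d + 1 / 16 ^ j"
    using near by (meson zero_less_divide_1_iff zero_less_numeral zero_less_power)
  then obtain g where gD: "\<And>j. g j \<in> ?D" and g_near: "\<And>j. energy M (H (g j)) < d + 1 / 16 ^ j"
    by metis
  have "energy M (\<lambda>x. H (g i) x - H (g j) x) \<le> 4 / 16 ^ j" if "j \<le> i" for i j :: nat
  proof -
    define s t :: real where "s = 1 / 16 ^ i" and "t = 1 / 16 ^ j"
    have "s \<le> t"
      unfolding s_def t_def using that by (intro divide_left_mono power_increasing) auto
    moreover have "energy M (H (g i)) < d + s" "energy M (H (g j)) < d + t"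
      unfolding s_def t_def by (rule g_near)+
    ultimately have "2 * (energy M (H (g i)) - d) + 2 * (energy M (H (g j)) - d) \<le> 4 * t"
      by argo
    with gap[OF gD gD, of i j] show ?thesis by (simp add: t_def)
  qed
  then obtain p where p: "p \<in> square_integrable M"
    and p_near: "\<And>j. energy M (\<lambda>x. p x - H (g j) x) \<le> 4 / 16 ^ j"
    using square_integrable_complete[of "\<lambda>j. H (g j)" M 4] H2[OF gD] by blast
  have lim0: "(\<lambda>j. c / 16 ^ j) \<longlonglongrightarrow> (0::real)" for c
    using tendsto_mult[OF tendsto_const[of c] LIMSEQ_power_zero[of "1 / 16 :: real"]]
    by (simp add: power_divide)
  have "energy M (\<lambda>x. p x - T p x) \<le> 40 / 16 ^ j" for j
  proof -
    let ?h = "H (g j)"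
    note hs = H2[OF gD[of j]]
    have q: "(\<lambda>x. p x - ?h x) \<in> square_integrable M"
      by (intro square_integrable_diff p hs)
    have r: "(\<lambda>x. ?h x - T ?h x) \<in> square_integrable M"
      by (intro square_integrable_diff T_square_integrable(1) hs)
    have s: "(\<lambda>x. ?h x - p x) \<in> square_integrable M"
      by (intro square_integrable_diff p hs)
    have "AE x in M. T (\<lambda>x. ?h x - p x) x = T ?h x - T p x"
      by (intro T_diff square_integrable_in_L1_plus_Linf p hs)
    then have "AE x in M. p x - T p x
        = ((p x - ?h x) + (?h x - T ?h x)) + T (\<lambda>x. ?h x - p x) x"
      by eventually_elim simp
    then have "energy M (\<lambda>x. p x - T p x)
        = energy M (\<lambda>x. ((p x - ?h x) + (?h x - T ?h x)) + T (\<lambda>x. ?h x - p x) x)"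
      by (intro energy_cong_AE meas square_integrable_diff square_integrable_add
          T_square_integrable(1) p q r s)
    also have "\<dots> \<le> 2 * energy M (\<lambda>x. (p x - ?h x) + (?h x - T ?h x))
        + 2 * energy M (T (\<lambda>x. ?h x - p x))"
      by (intro energy_add_le square_integrable_add T_square_integrable(1) q r s)
    also have "\<dots> \<le> 2 * (2 * energy M (\<lambda>x. p x - ?h x) + 2 * energy M (\<lambda>x. ?h x - T ?h x))
        + 2 * energy M (\<lambda>x. ?h x - p x)"
      by (intro add_mono mult_left_mono energy_add_le T_square_integrable(2) q r s) auto
    also have "energy M (\<lambda>x. ?h x - p x) = energy M (\<lambda>x. p x - ?h x)"
      by (simp add: energy_def power2_commute)
    also have "2 * (2 * energy M (\<lambda>x. p x - ?h x) + 2 * energy M (\<lambda>x. ?h x - T ?h x))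
        + 2 * energy M (\<lambda>x. p x - ?h x) \<le> 40 / 16 ^ j"
    proof -
      define s :: real where "s = 1 / 16 ^ j"
      have "energy M (\<lambda>x. p x - ?h x) \<le> 4 * s" "energy M ?h < d + s"
        using p_near[of j] g_near[of j] by (simp_all add: s_def)
      then have "2 * (2 * energy M (\<lambda>x. p x - ?h x) + 2 * energy M (\<lambda>x. ?h x - T ?h x))
          + 2 * energy M (\<lambda>x. p x - ?h x) \<le> 40 * s"
        using drift[OF gD, of j] by argo
      then show ?thesis by (simp add: s_def)
    qed
    finally show ?thesis .
  qed
  then have "energy M (\<lambda>x. p x - T p x) \<le> 0"
    by (intro LIMSEQ_le_const[OF lim0]) auto
  then have "energy M (\<lambda>x. p x - T p x) = 0"
    using energy_nonneg[of M "\<lambda>x. p x - T p x"] by simp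
  then have "AE x in M. (p x - T p x)\<^sup>2 = 0"
    using square_integrable_diff[OF p T_square_integrable(1)[OF p]]
    unfolding energy_def square_integrable_def
    by (subst (asm) integral_nonneg_eq_0_iff_AE) auto
  then have inv: "AE x in M. T p x = p x"
    by eventually_elim simp
  have "\<exists>g\<in>?D. energy M (\<lambda>x. p x - (f x - (g x - T g x))) \<le> \<epsilon>" if e: "0 < \<epsilon>" for \<epsilon>
  proof -
    have "eventually (\<lambda>j. 4 / 16 ^ j < \<epsilon>) sequentially"
      by (rule order_tendstoD(2)[OF lim0 e])
    then obtain j where "4 / 16 ^ j < \<epsilon>"
      by (auto simp: eventually_sequentially)
    then show ?thesis
      using p_near[of j] gD[of j] by (intro bexI[of _ "g j"]) (auto simp: H_def)
  qed
  then show ?thesis using p inv by blast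
qed

lemma average_invariant:
  assumes p: "p \<in> V" "AE x in M. T p x = p x"
  shows "AE x in M. convergent (\<lambda>n. ergodic_average T n p x)"
proof -
  have "AE x in M. (T ^^ k) p x = p x" for k
  proof (induction k)
    case (Suc k)
    have "AE x in M. T ((T ^^ k) p) x = T p x"
      using Suc by (intro T_cong iter_closed p)
    then show ?case
      using p(2) by eventually_elim simp
  qed simp
  then have "AE x in M. \<forall>k. (T ^^ k) p x = p x"
    unfolding AE_all_countable by simp
  then show ?thesis
  proof eventually_elim
    case (elim x)
    have "(\<lambda>n. ergodic_average T n p x) \<longlonglongrightarrow> p x"
    proof (rule tendsto_eventually, rule eventually_sequentiallyI[of 1])
      show "ergodic_average T n p x = p x" if "1 \<le> n" for n
        using elim that by (simp add: ergodic_average_def)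
    qed
    then show ?case by (rule convergentI)
  qed
qed

text \<open>The average of a coboundary telescopes to $(g - T^n g) / n$, and the iterates of a bounded
  function stay bounded.\<close>

lemma average_coboundary:
  assumes g: "g \<in> borel_measurable M" "AE x in M. \<bar>g x\<bar> \<le> B" "0 \<le> B"
  shows "AE x in M. convergent (\<lambda>n. ergodic_average T n (\<lambda>y. g y - T g y) x)"
proof -
  have gV: "g \<in> V" using g by (rule bounded_in_L1_plus_Linf)
  have "AE x in M. \<forall>k. (T ^^ k) (\<lambda>y. g y - T g y) x = (T ^^ k) g x - (T ^^ Suc k) g x"
    unfolding AE_all_countable
  proof
    show "AE x in M. (T ^^ k) (\<lambda>y. g y - T g y) x = (T ^^ k) g x - (T ^^ Suc k) g x" for k
      using iter_linear[OF gV T_closed[OF gV], of k 1 "-1"]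
      by (simp add: funpow_swap1)
  qed
  moreover have "AE x in M. \<forall>k. \<bar>(T ^^ k) g x\<bar> \<le> B"
    unfolding AE_all_countable using iter_bounded[OF g] by simp
  ultimately show ?thesis
  proof eventually_elim
    case (elim x)
    have eq: "ergodic_average T n (\<lambda>y. g y - T g y) x = (1 / real n) * (g x - (T ^^ n) g x)" for n
      using elim(1) sum_lessThan_telescope'[of "\<lambda>k. (T ^^ k) g x" n]
      by (simp add: ergodic_average_def)
    have "(\<lambda>n. ergodic_average T n (\<lambda>y. g y - T g y) x) \<longlonglongrightarrow> 0"
    proof (rule tendsto_0_le[where K = "2 * B"])
      show "(\<lambda>n. 1 / real n) \<longlonglongrightarrow> 0" by (rule lim_1_over_n)
      show "\<forall>\<^sub>F n in sequentially.
          norm (ergodic_average T n (\<lambda>y. g y - T g y) x) \<le> norm (1 / real n) * (2 * B)"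
      proof (rule always_eventually, rule allI)
        fix n
        have "\<bar>g x - (T ^^ n) g x\<bar> \<le> 2 * B"
          using elim(2)[rule_format, of n] elim(2)[rule_format, of 0] by simp
        then show "norm (ergodic_average T n (\<lambda>y. g y - T g y) x) \<le> norm (1 / real n) * (2 * B)"
          unfolding eq by (simp add: abs_mult divide_right_mono)
      qed
    qed
    then show ?case by (rule convergentI)
  qed
qed

text \<open>The error of the decomposition is small in mean square, hence has small excess.\<close>

lemma average_bounded_square_integrable_convergent:
  assumes f: "f \<in> bounded_square_integrable"
  shows "AE x in M. convergent (\<lambda>n. ergodic_average T n f x)"
proof (rule banach_principle)
  have f2: "f \<in> square_integrable M"
    using f by (simp add: bounded_square_integrable_def)
  show "f \<in> V" by (rule square_integrable_in_L1_plus_Linf[OF f2])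
  fix a \<delta> :: real assume a: "0 < a" and \<delta>: "0 < \<delta>"
  obtain p where p: "p \<in> square_integrable M" "AE x in M. T p x = p x"
    and dec: "\<And>\<epsilon>. 0 < \<epsilon> \<Longrightarrow> \<exists>g\<in>bounded_square_integrable.
      energy M (\<lambda>x. p x - (f x - (g x - T g x))) \<le> \<epsilon>"
    using mean_ergodic_decomposition[OF f] by blast
  obtain g where g: "g \<in> bounded_square_integrable"
    and g_near: "energy M (\<lambda>x. p x - (f x - (g x - T g x))) \<le> a * \<delta>"
    using dec[of "a * \<delta>"] a \<delta> by auto
  have g2: "g \<in> square_integrable M"
    using g by (simp add: bounded_square_integrable_def)
  obtain B where B: "0 \<le> B" "AE x in M. \<bar>g x\<bar> \<le> B"
    using g by (auto simp: bounded_square_integrable_def)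
  have pV: "p \<in> V" by (rule square_integrable_in_L1_plus_Linf[OF p(1)])
  have cV: "(\<lambda>x. g x - T g x) \<in> V"
    by (intro square_integrable_in_L1_plus_Linf square_integrable_diff T_square_integrable(1) g2)
  define b where "b x = p x + (g x - T g x)" for x
  have "b \<in> V"
    unfolding b_def [abs_def] by (intro L1_plus_Linf_add pV cV)
  moreover have "AE x in M. convergent (\<lambda>n. ergodic_average T n b x)"
  proof -
    have "AE x in M. convergent (\<lambda>n. ergodic_average T n (\<lambda>y. g y - T g y) x)"
      using g2 B by (intro average_coboundary) (auto simp: square_integrable_def)
    then show ?thesis
      using average_invariant[OF pV p(2)] average_add[OF pV cV]
      by eventually_elim (simp add: b_def [abs_def] convergent_add)
  qed
  moreover have "excess M a (\<lambda>x. f x - b x) \<le> ennreal \<delta>"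
  proof -
    let ?e = "\<lambda>x. p x - (f x - (g x - T g x))"
    have "?e \<in> square_integrable M"
      by (intro square_integrable_diff T_square_integrable(1) g2 f2 p)
    have "\<bar>f x - b x\<bar> = \<bar>?e x\<bar>" for x
      by (simp add: b_def)
    then have "excess M a (\<lambda>x. f x - b x) = excess M a ?e"
      unfolding excess_def by simp
    also have "\<dots> \<le> ennreal (energy M ?e / a)"
      by (rule excess_le_energy) fact+
    also have "\<dots> \<le> ennreal \<delta>"
      using g_near a by (intro ennreal_leI) (simp add: field_simps)
    finally show ?thesis .
  qed
  ultimately show "\<exists>b\<in>V. (AE x in M. convergent (\<lambda>n. ergodic_average T n b x)) \<and>
      excess M a (\<lambda>x. f x - b x) \<le> ennreal \<delta>" by blast
qed

text \<open>If \<open>f\<close> takes large values only on a set of finite measure, then discarding the values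
  of modulus at most \<open>a\<close> and the very large ones leaves a bounded square integrable function,
  and the excess over \<open>a\<close> of the discarded part is arbitrarily small.\<close>

lemma average_convergent:
  assumes f: "f \<in> V"
    and fin: "\<And>l. 0 < l \<Longrightarrow> emeasure M {x \<in> space M. \<bar>f x\<bar> > l} < \<infinity>"
  shows "AE x in M. convergent (\<lambda>n. ergodic_average T n f x)"
proof (rule banach_principle[OF f])
  fix a \<delta> :: real assume a: "0 < a" and \<delta>: "0 < \<delta>"
  have [measurable]: "f \<in> borel_measurable M" using f by measurable
  have exc: "excess M a f < \<infinity>"
  proof -
    obtain B where B: "0 \<le> B" "excess M B f < \<infinity>"
      using f by (auto simp: L1_plus_Linf_iff)
    have "excess M a f
        \<le> (\<integral>\<^sup>+ x. ennreal (\<bar>f x\<bar> - B) + ennreal B * indicator {x \<in> space M. \<bar>f x\<bar> > a} x \<partial>M)"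
      unfolding excess_def
    proof (rule nn_integral_mono)
      fix x assume x: "x \<in> space M"
      show "ennreal (\<bar>f x\<bar> - a)
          \<le> ennreal (\<bar>f x\<bar> - B) + ennreal B * indicator {x \<in> space M. \<bar>f x\<bar> > a} x"
      proof (cases "\<bar>f x\<bar> > a")
        case True
        then show ?thesis
          using x a B(1) ennreal_le_add_positive_parts[of "\<bar>f x\<bar> - a" "\<bar>f x\<bar> - B" B] by simp
      qed (simp add: ennreal_neg)
    qed
    also have "\<dots> = excess M B f + ennreal B * emeasure M {x \<in> space M. \<bar>f x\<bar> > a}"
      by (simp add: nn_integral_add excess_def nn_integral_cmult_indicator)
    also have "\<dots> < \<infinity>"
      using B fin[OF a] by (simp add: ennreal_mult_less_top)
    finally show ?thesis .
  qed
  define b where "b k x = (if a < \<bar>f x\<bar> \<and> \<bar>f x\<bar> \<le> real k then f x else 0)" for k x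
  have [measurable]: "b k \<in> borel_measurable M" for k
    unfolding b_def by measurable
  have b2: "b k \<in> bounded_square_integrable" for k
  proof -
    have "(\<integral>\<^sup>+ x. ennreal ((b k x)\<^sup>2) \<partial>M)
        \<le> (\<integral>\<^sup>+ x. ennreal ((real k)\<^sup>2) * indicator {x \<in> space M. \<bar>f x\<bar> > a} x \<partial>M)"
      by (intro nn_integral_mono) (auto simp: b_def abs_le_square_iff [symmetric] intro!: ennreal_leI)
    also have "\<dots> = ennreal ((real k)\<^sup>2) * emeasure M {x \<in> space M. \<bar>f x\<bar> > a}"
      by (simp add: nn_integral_cmult_indicator)
    also have "\<dots> < \<infinity>"
      using fin[OF a] by (simp add: ennreal_mult_less_top)
    finally have "b k \<in> square_integrable M"
      by (subst square_integrable_iff_nn) auto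
    then show ?thesis
      by (auto simp: bounded_square_integrable_def b_def intro!: exI[of _ "real k"])
  qed
  have "(\<lambda>k. \<integral>\<^sup>+ x. ennreal (\<bar>f x - b k x\<bar> - a) \<partial>M) \<longlonglongrightarrow> (\<integral>\<^sup>+ x. 0 \<partial>M)"
  proof (rule nn_integral_dominated_convergence[where w = "\<lambda>x. ennreal (\<bar>f x\<bar> - a)"])
    show "(\<integral>\<^sup>+ x. ennreal (\<bar>f x\<bar> - a) \<partial>M) < \<infinity>"
      using exc by (simp add: excess_def)
    show "AE x in M. ennreal (\<bar>f x - b k x\<bar> - a) \<le> ennreal (\<bar>f x\<bar> - a)" for k
      by (auto simp: b_def intro!: ennreal_leI)
    show "AE x in M. (\<lambda>k. ennreal (\<bar>f x - b k x\<bar> - a)) \<longlonglongrightarrow> 0"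
    proof (rule AE_I2, rule tendsto_eventually)
      fix x
      obtain N where "\<bar>f x\<bar> \<le> real N" using real_arch_simple by blast
      then have "ennreal (\<bar>f x - b k x\<bar> - a) = 0" if "N \<le> k" for k
        using that a by (auto simp: b_def ennreal_neg)
      then show "\<forall>\<^sub>F k in sequentially. ennreal (\<bar>f x - b k x\<bar> - a) = 0"
        by (rule eventually_sequentiallyI)
    qed
  qed auto
  then have "(\<lambda>k. excess M a (\<lambda>x. f x - b k x)) \<longlonglongrightarrow> 0"
    by (simp add: excess_def)
  then have "\<forall>\<^sub>F k in sequentially. excess M a (\<lambda>x. f x - b k x) < ennreal \<delta>"
    using \<delta> by (intro order_tendstoD(2)) auto
  then obtain k where "excess M a (\<lambda>x. f x - b k x) < ennreal \<delta>"
    by (auto simp: eventually_sequentially)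
  moreover have "b k \<in> V"
    using b2[of k] by (simp add: bounded_square_integrable_def square_integrable_in_L1_plus_Linf)
  ultimately show "\<exists>b\<in>V. (AE x in M. convergent (\<lambda>n. ergodic_average T n b x)) \<and>
      excess M a (\<lambda>x. f x - b x) \<le> ennreal \<delta>"
    using average_bounded_square_integrable_convergent[OF b2[of k]] by (intro bexI[of _ "b k"]) auto
qed

end

section \<open>Vanishing rearrangements\<close>

text \<open>Chebyshev's inequality, applied to the excess.\<close>

lemma L1_plus_Linf_level_set_small:
  assumes f: "f \<in> L1_plus_Linf M" and t: "0 < t"
  shows "\<exists>l>0. emeasure M {x \<in> space M. \<bar>f x\<bar> > l} \<le> ennreal t"
proof -
  have [measurable]: "f \<in> borel_measurable M" using f by measurable
  obtain a where a: "0 \<le> a" "excess M a f < \<infinity>"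
    using f by (auto simp: L1_plus_Linf_iff)
  define K where "K = enn2real (excess M a f)"
  have K: "excess M a f = ennreal K" "0 \<le> K"
    using a(2) by (auto simp: K_def less_top)
  define r where "r = K / t + 1"
  have r: "0 < r" "K \<le> r * t"
    using K(2) t by (auto simp: r_def field_simps add_pos_nonneg)
  let ?S = "{x \<in> space M. \<bar>f x\<bar> > a + r}"
  have "ennreal r * emeasure M ?S = (\<integral>\<^sup>+ x. ennreal r * indicator ?S x \<partial>M)"
    by (simp add: nn_integral_cmult_indicator)
  also have "\<dots> \<le> excess M a f"
    unfolding excess_def
    by (intro nn_integral_mono) (auto simp: indicator_def intro!: ennreal_leI)
  also have "\<dots> \<le> ennreal r * ennreal t"
    using K r t by (simp add: ennreal_mult' [symmetric] ennreal_leI)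
  finally have "emeasure M ?S \<le> ennreal t"
    using r(1) by (subst (asm) ennreal_mult_le_mult_iff) auto
  then show ?thesis
    using a(1) r(1) by (intro exI[of _ "a + r"]) auto
qed

text \<open>The rearrangement at \<open>t\<close> is below \<open>l\<close> once \<open>t\<close> exceeds the measure of a level set at a
  height smaller than \<open>l\<close>; the preceding bound rules out that the infimum defining it is taken
  over the empty set.\<close>

lemma R_space_iff:
  "f \<in> R_space M \<longleftrightarrow>
    f \<in> L1_plus_Linf M \<and> (\<forall>l>0. emeasure M {x \<in> space M. \<bar>f x\<bar> > l} < \<infinity>)"
proof -
  define S where "S t = {l. 0 < l \<and> emeasure M {x \<in> space M. \<bar>f x\<bar> > l} \<le> ennreal t}" for t
  have rearr: "rearrangement M f t = Inf (S t)" for t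
    by (simp add: rearrangement_def S_def)
  have bdd: "bdd_below (S t)" for t
    by (rule bdd_belowI[of _ 0]) (auto simp: S_def)
  show ?thesis
  proof (cases "f \<in> L1_plus_Linf M")
    case f: True
    have [measurable]: "f \<in> borel_measurable M" using f by measurable
    have ne: "S t \<noteq> {}" if "0 < t" for t
      using L1_plus_Linf_level_set_small[OF f that] by (auto simp: S_def)
    have "(rearrangement M f \<longlongrightarrow> 0) at_top
        \<longleftrightarrow> (\<forall>l>0. emeasure M {x \<in> space M. \<bar>f x\<bar> > l} < \<infinity>)"
    proof
      assume lim: "(rearrangement M f \<longlongrightarrow> 0) at_top"
      show "\<forall>l>0. emeasure M {x \<in> space M. \<bar>f x\<bar> > l} < \<infinity>"
      proof (intro allI impI)
        fix l :: real assume "0 < l"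
        then have "\<forall>\<^sub>F t in at_top. rearrangement M f t < l \<and> 0 < t"
          by (intro eventually_conj order_tendstoD(2)[OF lim] eventually_gt_at_top)
        then obtain t where t: "rearrangement M f t < l" "0 < t"
          by (metis (mono_tags, lifting) eventually_happens trivial_limit_at_top_linorder)
        then obtain k where "k \<in> S t" "k < l"
          unfolding rearr using cInf_lessD[OF ne[OF t(2)]] by blast
        have "emeasure M {x \<in> space M. \<bar>f x\<bar> > l} \<le> emeasure M {x \<in> space M. \<bar>f x\<bar> > k}"
          using \<open>k < l\<close> by (intro emeasure_mono) auto
        also have "\<dots> \<le> ennreal t"
          using \<open>k \<in> S t\<close> by (simp add: S_def)
        also have "\<dots> < \<infinity>" by simp
        finally show "emeasure M {x \<in> space M. \<bar>f x\<bar> > l} < \<infinity>" .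
      qed
    next
      assume fin: "\<forall>l>0. emeasure M {x \<in> space M. \<bar>f x\<bar> > l} < \<infinity>"
      show "(rearrangement M f \<longlongrightarrow> 0) at_top"
      proof (rule tendstoI)
        fix e :: real assume e: "0 < e"
        define t0 where "t0 = enn2real (emeasure M {x \<in> space M. \<bar>f x\<bar> > e / 2})"
        have "emeasure M {x \<in> space M. \<bar>f x\<bar> > e / 2} < \<infinity>"
          using fin e by (meson half_gt_zero)
        then have "emeasure M {x \<in> space M. \<bar>f x\<bar> > e / 2} = ennreal t0"
          unfolding t0_def by (intro ennreal_enn2real[symmetric]) simp
        then have mem: "e / 2 \<in> S t" if "t0 \<le> t" for t
          using that e by (auto simp: S_def intro: ennreal_leI)
        have "dist (rearrangement M f t) 0 < e" if t: "max t0 1 \<le> t" for t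
        proof -
          have "rearrangement M f t \<le> e / 2"
            unfolding rearr using t by (intro cInf_lower mem bdd) auto
          moreover have "0 \<le> rearrangement M f t"
            unfolding rearr using t by (intro cInf_greatest ne) (auto simp: S_def)
          ultimately show ?thesis using e by simp
        qed
        then show "\<forall>\<^sub>F t in at_top. dist (rearrangement M f t) 0 < e"
          by (rule eventually_at_top_linorderI)
      qed
    qed
    then show ?thesis using f by (simp add: R_space_def)
  qed (simp add: R_space_def)
qed

section \<open>Divergent averages\<close>

text \<open>Blocks of alternating sign and doubling length: the average over the block
  $[2^j, 2^{j+1})$ is the difference of two averages with the same limit, yet it is bounded away
  from zero with a sign that depends on the parity of \<open>j\<close>.\<close>

lemma alternating_blocks_average_not_convergent:
  fixes a :: "nat \<Rightarrow> real"
  assumes l: "0 < l"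
    and block: "\<And>k. 1 \<le> k \<Longrightarrow> l \<le> (- 1) ^ floor_log k * a k"
  shows "\<not> convergent (\<lambda>n. (1 / real n) * (\<Sum>k<n. a k))"
proof
  let ?A = "\<lambda>n. (1 / real n) * (\<Sum>k<n. a k)"
  assume "convergent ?A"
  then obtain L where L: "?A \<longlonglongrightarrow> L" by (auto simp: convergent_def)
  have pow: "filterlim (\<lambda>j. 2 ^ j :: nat) at_top sequentially"
    by (rule filterlim_subseq) (simp add: strict_mono_Suc_iff)
  define B where "B j = ?A (2 ^ Suc j) - (1 / 2) * ?A (2 ^ j)" for j
  have B_lim: "B \<longlonglongrightarrow> L - (1 / 2) * L"
    unfolding B_def
    by (intro tendsto_diff tendsto_mult_left filterlim_compose[OF L pow] LIMSEQ_Suc[OF filterlim_compose[OF L pow]])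
  have B_eq: "B j = (1 / 2 ^ Suc j) * (\<Sum>k=2 ^ j..<2 ^ Suc j. a k)" for j
  proof -
    have "(\<Sum>k<2 ^ Suc j. a k) = (\<Sum>k<2 ^ j. a k) + (\<Sum>k=2 ^ j..<2 ^ Suc j. a k)"
      unfolding lessThan_atLeast0 by (rule sum.atLeastLessThan_concat [symmetric]) auto
    then show ?thesis by (simp add: B_def field_simps)
  qed
  have B_ge: "l / 2 \<le> (- 1) ^ j * B j" for j
  proof -
    have flog: "floor_log k = j" if "k \<in> {2 ^ j..<2 ^ Suc j}" for k
      using that by (intro floor_log_eqI) auto
    have "2 ^ j * l = (\<Sum>k=2 ^ j..<(2 ^ Suc j :: nat). l)" by simp
    also have "\<dots> \<le> (\<Sum>k=2 ^ j..<2 ^ Suc j. (- 1) ^ j * a k)"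
    proof (rule sum_mono)
      fix k :: nat assume k: "k \<in> {2 ^ j..<2 ^ Suc j}"
      have "1 \<le> (2::nat) ^ j" by simp
      then show "l \<le> (- 1) ^ j * a k"
        using block[of k] flog[OF k] k by auto
    qed
    also have "\<dots> = (- 1) ^ j * (\<Sum>k=2 ^ j..<2 ^ Suc j. a k)"
      by (rule sum_distrib_left [symmetric])
    finally have "2 ^ j * l / 2 ^ Suc j \<le> (- 1) ^ j * (\<Sum>k=2 ^ j..<2 ^ Suc j. a k) / 2 ^ Suc j"
      by (rule divide_right_mono) simp
    then show ?thesis by (simp add: B_eq)
  qed
  have "(\<lambda>j. B (2 * j)) \<longlonglongrightarrow> L - (1 / 2) * L"
    by (rule filterlim_compose[OF B_lim]) (rule filterlim_subseq, simp add: strict_mono_Suc_iff)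
  moreover have "l / 2 \<le> B (2 * j)" for j
    using B_ge[of "2 * j"] by simp
  ultimately have 1: "l / 2 \<le> L - (1 / 2) * L"
    by (intro LIMSEQ_le_const) auto
  have "(\<lambda>j. B (2 * j + 1)) \<longlonglongrightarrow> L - (1 / 2) * L"
    by (rule filterlim_compose[OF B_lim]) (rule filterlim_subseq, simp add: strict_mono_Suc_iff)
  moreover have "B (2 * j + 1) \<le> - (l / 2)" for j
    using B_ge[of "2 * j + 1"] by simp
  ultimately have "L - (1 / 2) * L \<le> - (l / 2)"
    by (intro LIMSEQ_le_const2) auto
  with 1 l show False by simp
qed

text \<open>The operator replaces a function on each level set of \<open>\<kappa>\<close> by its mean over the next
  level, with a sign. Since the levels grow in measure, averaging over the next level
  contracts $L^1$ as well as $L^\infty$. The level \<open>0\<close> collects the points outside the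
  chain. Writing the sign as a product of consecutive \<open>\<sigma>\<close> makes the signs of the iterates
  telescope.\<close>

locale level_chain =
  fixes M :: "'a measure" and \<kappa> :: "'a \<Rightarrow> nat" and \<sigma> :: "nat \<Rightarrow> real"
  assumes \<kappa>_measurable [measurable]: "\<kappa> \<in> measurable M (count_space UNIV)"
    and level_finite: "\<And>j. 1 \<le> j \<Longrightarrow> emeasure M {x \<in> space M. \<kappa> x = j} < \<infinity>"
    and level_pos: "0 < emeasure M {x \<in> space M. \<kappa> x = 1}"
    and level_mono: "\<And>j. 1 \<le> j \<Longrightarrow>
      emeasure M {x \<in> space M. \<kappa> x = j} \<le> emeasure M {x \<in> space M. \<kappa> x = Suc j}"
    and sign: "\<And>j. \<bar>\<sigma> j\<bar> = 1"
begin

definition level :: "nat \<Rightarrow> 'a set" where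
  "level j = {x \<in> space M. \<kappa> x = j}"

definition level_size :: "nat \<Rightarrow> real" where
  "level_size j = measure M (level j)"

definition level_mean :: "('a \<Rightarrow> real) \<Rightarrow> nat \<Rightarrow> real" where
  "level_mean f j = (LINT x|M. indicator (level j) x * f x) / level_size j"

definition shift :: "('a \<Rightarrow> real) \<Rightarrow> 'a \<Rightarrow> real" where
  "shift f x = (if \<kappa> x = 0 then 0 else \<sigma> (\<kappa> x) * \<sigma> (Suc (\<kappa> x)) * level_mean f (Suc (\<kappa> x)))"

lemma level_measurable [measurable]: "level j \<in> sets M"
  unfolding level_def by measurable

lemma emeasure_level: "1 \<le> j \<Longrightarrow> emeasure M (level j) = ennreal (level_size j)"
  using level_finite[of j] unfolding level_size_def level_def
  by (intro emeasure_eq_ennreal_measure) (simp add: less_top)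

lemma level_size_nonneg: "0 \<le> level_size j"
  by (simp add: level_size_def)

lemma level_size_mono: "1 \<le> j \<Longrightarrow> level_size j \<le> level_size (Suc j)"
  using level_mono[of j] level_size_nonneg
  by (simp add: emeasure_level[unfolded level_def])

lemma level_size_pos: "1 \<le> j \<Longrightarrow> 0 < level_size j"
proof (induction j rule: dec_induct)
  case base
  show ?case
    using level_pos by (simp add: emeasure_level[unfolded level_def])
next
  case (step n)
  then show ?case using level_size_mono[of n] by simp
qed

lemma integrable_on_level:
  assumes f: "f \<in> L1_plus_Linf M" and j: "1 \<le> j"
  shows "integrable M (\<lambda>x. indicator (level j) x * f x)"
proof -
  have [measurable]: "f \<in> borel_measurable M" using f by measurable
  obtain a where a: "0 \<le> a" "excess M a f < \<infinity>"
    using f by (auto simp: L1_plus_Linf_iff)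
  have "(\<integral>\<^sup>+ x. ennreal \<bar>indicator (level j) x * f x\<bar> \<partial>M)
      \<le> (\<integral>\<^sup>+ x. ennreal (\<bar>f x\<bar> - a) + ennreal a * indicator (level j) x \<partial>M)"
  proof (rule nn_integral_mono)
    fix x
    show "ennreal \<bar>indicator (level j) x * f x\<bar>
        \<le> ennreal (\<bar>f x\<bar> - a) + ennreal a * indicator (level j) x"
      using ennreal_le_add_positive_parts[of "\<bar>f x\<bar>" "\<bar>f x\<bar> - a" a] a(1)
      by (cases "x \<in> level j") auto
  qed
  also have "\<dots> = excess M a f + ennreal a * emeasure M (level j)"
    by (simp add: nn_integral_add excess_def nn_integral_cmult_indicator)
  also have "\<dots> < \<infinity>"
    using a by (simp add: emeasure_level[OF j] ennreal_mult_less_top)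
  finally show ?thesis
    by (simp add: integrable_iff_bounded)
qed

lemma shift_measurable: "shift f \<in> borel_measurable M"
proof -
  have "(\<lambda>j. if j = 0 then 0 else \<sigma> j * \<sigma> (Suc j) * level_mean f (Suc j)) \<circ> \<kappa> \<in> borel_measurable M"
    by (rule measurable_comp[OF \<kappa>_measurable]) simp
  then show ?thesis by (simp add: comp_def shift_def [abs_def])
qed

lemma shift_outside: "\<kappa> x = 0 \<Longrightarrow> shift f x = 0"
  by (simp add: shift_def)

lemma abs_shift: "\<kappa> x \<noteq> 0 \<Longrightarrow> \<bar>shift f x\<bar> = \<bar>level_mean f (Suc (\<kappa> x))\<bar>"
  by (simp add: shift_def abs_mult sign)

lemma level_mean_bounded:
  assumes f: "f \<in> borel_measurable M" "AE x in M. \<bar>f x\<bar> \<le> B" "0 \<le> B" and j: "1 \<le> j"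
  shows "\<bar>level_mean f j\<bar> \<le> B"
proof -
  note [measurable] = f(1)
  have fV: "f \<in> L1_plus_Linf M" using f by (rule bounded_in_L1_plus_Linf)
  have "integrable M (\<lambda>x. B * indicator (level j) x)"
    by (intro integrable_mult_right integrable_real_indicator) (auto simp: emeasure_level[OF j])
  then have "(LINT x|M. \<bar>indicator (level j) x * f x\<bar>) \<le> (LINT x|M. B * indicator (level j) x)"
    using f(2) integrable_on_level[OF fV j]
    by (intro integral_mono_AE) (auto simp: indicator_def f(3))
  then have "\<bar>LINT x|M. indicator (level j) x * f x\<bar> \<le> (LINT x|M. B * indicator (level j) x)"
    by (rule order_trans[OF integral_abs_bound])
  also have "\<dots> = B * level_size j"
    by (simp add: level_size_def)
  finally show ?thesis
    using level_size_pos[OF j] by (simp add: level_mean_def abs_divide field_simps)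
qed

lemma level_mean_linear:
  assumes "f \<in> L1_plus_Linf M" "g \<in> L1_plus_Linf M" "1 \<le> j"
  shows "level_mean (\<lambda>y. a * f y + b * g y) j = a * level_mean f j + b * level_mean g j"
proof -
  have "(LINT x|M. indicator (level j) x * (a * f x + b * g x))
      = (LINT x|M. a * (indicator (level j) x * f x) + b * (indicator (level j) x * g x))"
    by (simp add: algebra_simps)
  also have "\<dots> = a * (LINT x|M. indicator (level j) x * f x)
      + b * (LINT x|M. indicator (level j) x * g x)"
    using integrable_on_level[OF assms(1,3)] integrable_on_level[OF assms(2,3)] by simp
  finally show ?thesis
    by (simp add: level_mean_def add_divide_distrib)
qed

lemma shift_linear:
  assumes "f \<in> L1_plus_Linf M" "g \<in> L1_plus_Linf M"
  shows "shift (\<lambda>y. a * f y + b * g y) = (\<lambda>x. a * shift f x + b * shift g x)"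
  by (rule ext) (simp add: shift_def level_mean_linear[OF assms] algebra_simps)

lemma shift_bounded:
  assumes "f \<in> borel_measurable M" "AE x in M. \<bar>f x\<bar> \<le> B" "0 \<le> B"
  shows "\<bar>shift f x\<bar> \<le> B"
  using level_mean_bounded[OF assms, of "Suc (\<kappa> x)"] assms(3)
  by (cases "\<kappa> x = 0") (simp_all add: abs_shift shift_outside)

lemma suminf_indicator_level:
  "x \<in> space M \<Longrightarrow> (\<Sum>j. F j * indicator (level j) x) = (F (\<kappa> x) :: ennreal)"
  by (subst suminf_finite[of "{\<kappa> x}"]) (auto simp: level_def indicator_def)

text \<open>Level \<open>j\<close> receives in modulus at most the integral of \<open>f\<close> over level \<open>Suc j\<close>, scaled by
  the ratio of the two measures, which is at most one.\<close>

lemma shift_L1_contraction: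
  assumes f: "f \<in> L1_space M"
  shows "excess M 0 (shift f) \<le> excess M 0 f"
proof -
  have [measurable]: "f \<in> borel_measurable M" using f by (simp add: L1_space_iff)
  have fV: "f \<in> L1_plus_Linf M"
    using f by (intro finite_excess_in_L1_plus_Linf[of _ _ 0]) (auto simp: L1_space_iff)
  define c where "c j = (if j = 0 then 0 else ennreal \<bar>level_mean f (Suc j)\<bar>)" for j
  define w where "w j = (\<integral>\<^sup>+ x. ennreal \<bar>f x\<bar> * indicator (level j) x \<partial>M)" for j
  have c_le: "c j * emeasure M (level j) \<le> w (Suc j)" for j
  proof (cases "j = 0")
    case False
    then have j: "1 \<le> j" by simp
    have pos: "0 < level_size (Suc j)" by (rule level_size_pos) simp
    have "\<bar>level_mean f (Suc j)\<bar> * level_size j \<le> \<bar>level_mean f (Suc j)\<bar> * level_size (Suc j)"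
      by (intro mult_left_mono level_size_mono j) simp
    also have "\<dots> = \<bar>LINT x|M. indicator (level (Suc j)) x * f x\<bar>"
      using pos by (simp add: level_mean_def abs_divide)
    finally have le: "\<bar>level_mean f (Suc j)\<bar> * level_size j
        \<le> \<bar>LINT x|M. indicator (level (Suc j)) x * f x\<bar>" .
    have "c j * emeasure M (level j) = ennreal (\<bar>level_mean f (Suc j)\<bar> * level_size j)"
      using False by (simp add: c_def emeasure_level[OF j] ennreal_mult')
    also have "\<dots> \<le> ennreal (norm (LINT x|M. indicator (level (Suc j)) x * f x))"
      using le by (intro ennreal_leI) simp
    also have "\<dots> \<le> (\<integral>\<^sup>+ x. ennreal (norm (indicator (level (Suc j)) x * f x)) \<partial>M)"
      by (intro integral_norm_bound_ennreal integrable_on_level fV) simp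
    also have "\<dots> = w (Suc j)"
      unfolding w_def by (intro nn_integral_cong) (auto simp: indicator_def)
    finally show ?thesis .
  qed (simp add: c_def)
  have "excess M 0 (shift f) = (\<integral>\<^sup>+ x. c (\<kappa> x) \<partial>M)"
    unfolding excess_def by (intro nn_integral_cong) (simp add: c_def abs_shift shift_outside)
  also have "\<dots> = (\<integral>\<^sup>+ x. (\<Sum>j. c j * indicator (level j) x) \<partial>M)"
    by (intro nn_integral_cong) (simp add: suminf_indicator_level)
  also have "\<dots> = (\<Sum>j. c j * emeasure M (level j))"
    by (simp add: nn_integral_suminf nn_integral_cmult_indicator)
  also have "\<dots> \<le> (\<Sum>j. w (Suc j))"
    by (intro suminf_le c_le) auto
  also have "\<dots> \<le> w 0 + (\<Sum>j. w (Suc j))" by simp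
  also have "\<dots> = (\<Sum>j. w j)"
    using suminf_offset[of w 1] by (simp add: add.commute)
  also have "\<dots> = (\<integral>\<^sup>+ x. (\<Sum>j. ennreal \<bar>f x\<bar> * indicator (level j) x) \<partial>M)"
    unfolding w_def by (rule nn_integral_suminf [symmetric]) simp
  also have "\<dots> = excess M 0 f"
    unfolding excess_def
  proof (intro nn_integral_cong)
    fix x assume "x \<in> space M"
    from suminf_indicator_level[OF this, of "\<lambda>j. ennreal \<bar>f x\<bar>"]
    show "(\<Sum>j. ennreal \<bar>f x\<bar> * indicator (level j) x) = ennreal (\<bar>f x\<bar> - 0)" by simp
  qed
  finally show ?thesis .
qed

lemma dunford_schwartz_shift: "dunford_schwartz M shift"
  unfolding dunford_schwartz_def
proof (intro conjI ballI allI impI)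
  show L1: "L1_norm M (shift f) \<le> L1_norm M f" if "f \<in> L1_space M" for f
    using shift_L1_contraction[OF that] by (simp add: L1_norm_def excess_def)
  show Linf: "Linf_norm M (shift f) \<le> Linf_norm M f" if f: "f \<in> Linf_space M" for f
  proof -
    have fm: "f \<in> borel_measurable M" using f by (simp add: Linf_space_iff)
    define B where "B = enn2real (Linf_norm M f)"
    have B: "Linf_norm M f = ennreal B" "0 \<le> B"
      using f by (auto simp: B_def Linf_space_def less_top)
    then have "AE x in M. \<bar>f x\<bar> \<le> B"
      using fm by (subst Linf_norm_le_iff [symmetric]) auto
    then have "\<bar>shift f x\<bar> \<le> B" for x
      by (rule shift_bounded[OF fm _ B(2)])
    then show ?thesis
      unfolding B(1) Linf_norm_le_iff[OF shift_measurable B(2)] by simp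
  qed
  show "shift f \<in> L1_plus_Linf M" if f: "f \<in> L1_plus_Linf M" for f
  proof -
    obtain g h where g: "g \<in> L1_space M" and h: "h \<in> Linf_space M" and fgh: "f = (\<lambda>x. g x + h x)"
      using f by (auto simp: L1_plus_Linf_def)
    have gV: "g \<in> L1_plus_Linf M"
      using g by (intro finite_excess_in_L1_plus_Linf[of _ _ 0]) (auto simp: L1_space_iff)
    have hV: "h \<in> L1_plus_Linf M"
      using h by (auto simp: Linf_space_iff intro: bounded_in_L1_plus_Linf)
    have "shift g \<in> L1_plus_Linf M"
      using shift_L1_contraction[OF g] g shift_measurable
      by (intro finite_excess_in_L1_plus_Linf[of _ _ 0]) (auto simp: L1_space_iff intro: le_less_trans)
    moreover have "shift h \<in> L1_plus_Linf M"
    proof -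
      obtain B where B: "h \<in> borel_measurable M" "AE x in M. \<bar>h x\<bar> \<le> B" "0 \<le> B"
        using h by (auto simp: Linf_space_iff)
      show ?thesis
        using shift_bounded[OF B]
        by (intro bounded_in_L1_plus_Linf[where B = B] shift_measurable B(3)) simp
    qed
    moreover have "shift f = (\<lambda>x. shift g x + shift h x)"
      using shift_linear[OF gV hV, of 1 1] by (simp add: fgh)
    ultimately show ?thesis by (simp add: L1_plus_Linf_add)
  qed
  show "AE x in M. shift f x = shift g x"
    if "f \<in> L1_plus_Linf M" "g \<in> L1_plus_Linf M" "AE x in M. f x = g x" for f g
  proof -
    have [measurable]: "f \<in> borel_measurable M" "g \<in> borel_measurable M"
      using that by measurable
    have "level_mean f j = level_mean g j" for j
      unfolding level_mean_def using that(3)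
      by (intro arg_cong2[where f = "(/)"] integral_cong_AE) auto
    then show ?thesis by (simp add: shift_def)
  qed
  show "AE x in M. shift (\<lambda>y. a * f y + b * g y) x = a * shift f x + b * shift g x"
    if "f \<in> L1_plus_Linf M" "g \<in> L1_plus_Linf M" for f g a b
    by (simp add: shift_linear[OF that])
qed

lemma level_mean_shift:
  assumes "1 \<le> j"
  shows "level_mean (shift f) j = \<sigma> j * \<sigma> (Suc j) * level_mean f (Suc j)"
proof -
  have "(LINT x|M. indicator (level j) x * shift f x)
      = (LINT x|M. (\<sigma> j * \<sigma> (Suc j) * level_mean f (Suc j)) * indicator (level j) x)"
    using assms
    by (intro Bochner_Integration.integral_cong) (auto simp: level_def shift_def indicator_def)
  also have "\<dots> = (\<sigma> j * \<sigma> (Suc j) * level_mean f (Suc j)) * level_size j"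
    by (simp add: level_size_def)
  finally show ?thesis
    using level_size_pos[OF assms] by (simp add: level_mean_def)
qed

lemma sign_square: "\<sigma> j * \<sigma> j = 1"
  using sign[of j] abs_mult_self_eq[of "\<sigma> j"] by simp

lemma shift_iterate:
  assumes "\<kappa> x = 1"
  shows "(shift ^^ Suc n) f x = \<sigma> 1 * \<sigma> (Suc (Suc n)) * level_mean f (Suc (Suc n))"
proof (induction n arbitrary: f)
  case 0
  then show ?case using assms by (simp add: shift_def numeral_2_eq_2)
next
  case (Suc n)
  have "(shift ^^ Suc (Suc n)) f x = (shift ^^ Suc n) (shift f) x"
    by (simp only: funpow_Suc_right comp_def)
  also have "\<dots> = \<sigma> 1 * \<sigma> (Suc (Suc n)) * level_mean (shift f) (Suc (Suc n))"
    by (rule Suc)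
  also have "\<dots> = \<sigma> 1 * (\<sigma> (Suc (Suc n)) * \<sigma> (Suc (Suc n)))
      * \<sigma> (Suc (Suc (Suc n))) * level_mean f (Suc (Suc (Suc n)))"
    by (simp only: level_mean_shift mult.assoc le_add1 Suc_le_mono le0 One_nat_def)
  finally show ?case by (simp add: sign_square)
qed

end

text \<open>The factor \<open>c\<close>, of modulus one, covers functions that are large and positive and
  functions that are large and negative on the chain.\<close>

lemma divergent_average_of_level_chain:
  fixes \<kappa> :: "'a \<Rightarrow> nat"
  assumes \<kappa>: "\<kappa> \<in> measurable M (count_space UNIV)"
    and fin: "\<And>j. 1 \<le> j \<Longrightarrow> emeasure M {x \<in> space M. \<kappa> x = j} < \<infinity>"
    and pos: "0 < emeasure M {x \<in> space M. \<kappa> x = 1}"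
    and mono: "\<And>j. 1 \<le> j \<Longrightarrow>
      emeasure M {x \<in> space M. \<kappa> x = j} \<le> emeasure M {x \<in> space M. \<kappa> x = Suc j}"
    and f: "f \<in> L1_plus_Linf M" and l: "0 < l" and c: "\<bar>c\<bar> = 1"
    and large: "\<And>x. x \<in> space M \<Longrightarrow> \<kappa> x \<noteq> 0 \<Longrightarrow> l \<le> c * f x"
  shows "f \<notin> C_space M"
proof
  assume fC: "f \<in> C_space M"
  \<comment> \<open>On level \<open>1\<close> the \<open>k\<close>-th iterate carries the sign with index \<open>Suc k\<close>; hence the shift by one.\<close>
  define \<sigma> where "\<sigma> j = (- 1 :: real) ^ floor_log (j - 1)" for j
  interpret level_chain M \<kappa> \<sigma>
    by unfold_locales (use \<kappa> fin pos mono in \<open>auto simp: \<sigma>_def power_abs\<close>)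
  have mean: "l \<le> c * level_mean f j" if j: "1 \<le> j" for j
  proof -
    have "l * level_size j = (LINT x|M. l * indicator (level j) x)"
      by (simp add: level_size_def)
    also have "\<dots> \<le> (LINT x|M. c * (indicator (level j) x * f x))"
    proof (rule integral_mono)
      show "integrable M (\<lambda>x. l * indicator (level j) x)"
        by (intro integrable_mult_right integrable_real_indicator) (auto simp: emeasure_level[OF j])
      show "integrable M (\<lambda>x. c * (indicator (level j) x * f x))"
        by (intro integrable_mult_right integrable_on_level[OF f j])
      show "l * indicator (level j) x \<le> c * (indicator (level j) x * f x)" for x
        using large[of x] j by (cases "x \<in> level j") (auto simp: level_def)
    qed
    also have "\<dots> = c * (level_mean f j * level_size j)"
      using level_size_pos[OF j] by (simp add: level_mean_def)
    finally show ?thesis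
      using level_size_pos[OF j] by (simp add: mult.assoc [symmetric])
  qed
  have div: "\<not> convergent (\<lambda>n. ergodic_average shift n f x)" if x: "\<kappa> x = 1" for x
  proof
    let ?a = "\<lambda>k. (shift ^^ k) f x"
    assume "convergent (\<lambda>n. ergodic_average shift n f x)"
    then have "convergent (\<lambda>n. c * ((1 / real n) * (\<Sum>k<n. ?a k)))"
      unfolding ergodic_average_def by (rule convergent_mult[OF convergent_const])
    then have "convergent (\<lambda>n. (1 / real n) * (\<Sum>k<n. c * ?a k))"
      by (simp add: sum_distrib_left mult.left_commute)
    moreover have "l \<le> (- 1) ^ floor_log k * (c * ?a k)" if k: "1 \<le> k" for k
    proof -
      obtain n where n: "k = Suc n" using k by (cases k) auto
      have "?a k = (- 1) ^ floor_log k * level_mean f (Suc k)"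
        using shift_iterate[OF x, of n f] by (simp add: n \<sigma>_def)
      then have "(- 1) ^ floor_log k * (c * ?a k)
          = ((- 1) ^ floor_log k * (- 1) ^ floor_log k) * (c * level_mean f (Suc k))"
        by (simp only: mult_ac)
      also have "(- 1) ^ floor_log k * (- 1) ^ floor_log k = (1::real)"
        by (simp add: power_mult_distrib [symmetric])
      finally have eq: "(- 1) ^ floor_log k * (c * ?a k) = 1 * (c * level_mean f (Suc k))" .
      have "l \<le> c * level_mean f (Suc k)" by (rule mean) simp
      then show ?thesis unfolding eq by simp
    qed
    ultimately show False
      using alternating_blocks_average_not_convergent[OF l, of "\<lambda>k. c * ?a k"] by blast
  qed
  have "AE x in M. convergent (\<lambda>n. ergodic_average shift n f x)"
    using fC dunford_schwartz_shift by (auto simp: C_space_def)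
  then have "AE x in M. \<not> \<kappa> x = 1"
    using div by (auto elim: eventually_mono)
  then have "emeasure M {x \<in> space M. \<kappa> x = 1} = 0"
    by (subst (asm) AE_iff_measurable[OF _ refl]) auto
  then show False using pos by simp
qed

text \<open>A set of infinite measure in a $\sigma$-finite space contains disjoint sets of finite,
  nondecreasing, positive measure: exhaust it by sets of finite measure and pass to a subsequence
  along which the measure more than doubles.\<close>

lemma (in sigma_finite_measure) exists_level_chain:
  assumes E [measurable]: "E \<in> sets M" and inf: "emeasure M E = \<infinity>"
  shows "\<exists>\<kappa>. \<kappa> \<in> measurable M (count_space UNIV) \<and>
    (\<forall>x\<in>space M. \<kappa> x \<noteq> 0 \<longrightarrow> x \<in> E) \<and>
    (\<forall>j\<ge>1. emeasure M {x \<in> space M. \<kappa> x = j} < \<infinity>) \<and>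
    0 < emeasure M {x \<in> space M. \<kappa> x = 1} \<and>
    (\<forall>j\<ge>1. emeasure M {x \<in> space M. \<kappa> x = j} \<le> emeasure M {x \<in> space M. \<kappa> x = Suc j})"
proof -
  obtain F :: "nat \<Rightarrow> 'a set" where F: "range F \<subseteq> sets M" "(\<Union>i. F i) = space M"
    "\<And>i. emeasure M (F i) \<noteq> \<infinity>" "incseq F"
    using sigma_finite_incseq by blast
  have [measurable]: "F i \<in> sets M" for i using F(1) by auto
  define G where "G i = E \<inter> F i" for i
  have [measurable]: "G i \<in> sets M" for i by (simp add: G_def)
  have G_inc: "incseq G"
    using F(4) by (auto simp: G_def incseq_def)
  have G_fin: "emeasure M (G i) \<noteq> \<infinity>" for i
    using F(3)[of i] emeasure_mono[of "G i" "F i" M] by (auto simp: G_def top_unique)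
  define a where "a i = measure M (G i)" for i
  have a: "emeasure M (G i) = ennreal (a i)" "0 \<le> a i" for i
    using G_fin[of i] by (auto simp: a_def emeasure_eq_ennreal_measure)
  have "(\<Union>i. G i) = E"
    using F(2) sets.sets_into_space[OF E] by (auto simp: G_def)
  then have "(SUP i. emeasure M (G i)) = \<infinity>"
    using SUP_emeasure_incseq[of G M] G_inc inf by (simp add: image_subset_iff)
  then have unbounded: "\<exists>i>n. b < a i" for n b
  proof -
    have "ennreal (max b (a n)) < (SUP i. emeasure M (G i))"
      unfolding \<open>(SUP i. emeasure M (G i)) = \<infinity>\<close> by simp
    then obtain i where "ennreal (max b (a n)) < ennreal (a i)"
      by (auto simp: less_SUP_iff a)
    then have i: "max b (a n) < a i"
      by (simp add: ennreal_less_iff a(2) le_max_iff_disj)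
    have "n < i"
    proof (rule ccontr)
      assume "\<not> n < i"
      then have "a i \<le> a n"
        unfolding a_def using G_inc G_fin[of n]
        by (intro measure_mono_fmeasurable) (auto simp: incseq_def fmeasurable_def less_top)
      then show False using i by simp
    qed
    then show ?thesis using i by auto
  qed
  have "\<exists>n. \<forall>k. True \<and> (n k < n (Suc k) \<and> 2 * a (n k) + 1 < a (n (Suc k)))"
    by (rule dependent_nat_choice) (use unbounded in auto)
  then obtain n :: "nat \<Rightarrow> nat" where n_step: "\<And>k. n k < n (Suc k)"
    and a_step: "\<And>k. 2 * a (n k) + 1 < a (n (Suc k))" by auto
  have n_mono: "strict_mono n" using n_step by (simp add: strict_mono_Suc_iff)
  have Gn_inc: "incseq (\<lambda>k. G (n k))"
    using G_inc n_mono by (auto simp: incseq_def strict_mono_less_eq)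
  have E_cover: "\<exists>k. x \<in> G (n k)" if "x \<in> E" for x
  proof -
    obtain i where "x \<in> G i" using \<open>(\<Union>i. G i) = E\<close> \<open>x \<in> E\<close> by auto
    then have "x \<in> G (n i)"
      using G_inc strict_mono_imp_increasing[OF n_mono, of i] by (auto simp: incseq_def)
    then show ?thesis by blast
  qed
  \<comment> \<open>Level \<open>0\<close> takes the points outside \<open>E\<close> and also the first set of the sequence.\<close>
  define \<kappa> where "\<kappa> x = (if x \<in> E then LEAST k. x \<in> G (n k) else 0)" for x
  have level: "{x \<in> space M. \<kappa> x = Suc j} = G (n (Suc j)) - G (n j)" for j
  proof (intro set_eqI iffI)
    fix x assume "x \<in> {x \<in> space M. \<kappa> x = Suc j}"
    then have x: "x \<in> E" "(LEAST k. x \<in> G (n k)) = Suc j"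
      by (auto simp: \<kappa>_def split: if_splits)
    then show "x \<in> G (n (Suc j)) - G (n j)"
      using LeastI_ex[OF E_cover[OF x(1)]] not_less_Least[of j "\<lambda>k. x \<in> G (n k)"] by auto
  next
    fix x assume x: "x \<in> G (n (Suc j)) - G (n j)"
    have "(LEAST k. x \<in> G (n k)) = Suc j"
    proof (rule Least_equality)
      show "Suc j \<le> k" if "x \<in> G (n k)" for k
      proof (rule ccontr)
        assume "\<not> Suc j \<le> k"
        then have "G (n k) \<subseteq> G (n j)" using Gn_inc by (simp add: incseq_def)
        then show False using that x by auto
      qed
    qed (use x in simp)
    moreover have "x \<in> E" using x by (auto simp: G_def)
    moreover have "x \<in> space M" using sets.sets_into_space[OF E] \<open>x \<in> E\<close> by auto
    ultimately show "x \<in> {x \<in> space M. \<kappa> x = Suc j}" by (simp add: \<kappa>_def)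
  qed
  have size: "emeasure M {x \<in> space M. \<kappa> x = Suc j} = ennreal (a (n (Suc j)) - a (n j))" for j
  proof -
    have "emeasure M (G (n (Suc j)) - G (n j)) = emeasure M (G (n (Suc j))) - emeasure M (G (n j))"
      using Gn_inc by (intro emeasure_Diff) (auto simp: G_fin[unfolded infinity_ennreal_def] incseq_Suc_iff)
    then show ?thesis
      by (simp add: level a ennreal_minus)
  qed
  have "\<kappa> \<in> measurable M (count_space UNIV)"
    unfolding \<kappa>_def by measurable
  moreover have "\<forall>x\<in>space M. \<kappa> x \<noteq> 0 \<longrightarrow> x \<in> E"
    by (auto simp: \<kappa>_def)
  moreover have "\<forall>j\<ge>1. emeasure M {x \<in> space M. \<kappa> x = j} < \<infinity>"
    using size by (metis One_nat_def Suc_le_D ennreal_less_top infinity_ennreal_def)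
  moreover have "0 < emeasure M {x \<in> space M. \<kappa> x = 1}"
    using size[of 0] a_step[of 0] a(2)[of "n 0"] by simp
  moreover have "\<forall>j\<ge>1. emeasure M {x \<in> space M. \<kappa> x = j} \<le> emeasure M {x \<in> space M. \<kappa> x = Suc j}"
  proof (intro allI impI)
    fix j :: nat assume "1 \<le> j"
    then obtain i where j: "j = Suc i" by (cases j) auto
    have "a (n (Suc i)) - a (n i) \<le> a (n (Suc (Suc i))) - a (n (Suc i))"
      using a_step[of "Suc i"] a(2)[of "n i"] by simp
    then show "emeasure M {x \<in> space M. \<kappa> x = j} \<le> emeasure M {x \<in> space M. \<kappa> x = Suc j}"
      unfolding j size by (rule ennreal_leI)
  qed
  ultimately show ?thesis by blast
qed

section \<open>The two inclusions\<close>

lemma C_space_subset_R_space: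
  assumes "sigma_finite_measure M"
  shows "C_space M \<subseteq> R_space M"
proof
  fix f assume fC: "f \<in> C_space M"
  interpret sigma_finite_measure M by fact
  have fV: "f \<in> L1_plus_Linf M" using fC by (simp add: C_space_def)
  have [measurable]: "f \<in> borel_measurable M" using fV by measurable
  have no_large: "emeasure M {x \<in> space M. c * f x > l} < \<infinity>" if l: "0 < l" and c: "\<bar>c\<bar> = 1" for l c
  proof (rule ccontr)
    assume "\<not> emeasure M {x \<in> space M. c * f x > l} < \<infinity>"
    then have "emeasure M {x \<in> space M. c * f x > l} = \<infinity>"
      by (simp flip: top.not_eq_extremum)
    \<comment> \<open>A chain of levels inside this set would give an operator with divergent averages.\<close>
    then obtain \<kappa> :: "'a \<Rightarrow> nat" where \<kappa>: "\<kappa> \<in> measurable M (count_space UNIV)"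
      "\<forall>x\<in>space M. \<kappa> x \<noteq> 0 \<longrightarrow> x \<in> {x \<in> space M. c * f x > l}"
      "\<forall>j\<ge>1. emeasure M {x \<in> space M. \<kappa> x = j} < \<infinity>"
      "0 < emeasure M {x \<in> space M. \<kappa> x = 1}"
      "\<forall>j\<ge>1. emeasure M {x \<in> space M. \<kappa> x = j} \<le> emeasure M {x \<in> space M. \<kappa> x = Suc j}"
      using exists_level_chain[of "{x \<in> space M. c * f x > l}"] by auto
    have "f \<notin> C_space M"
      by (rule divergent_average_of_level_chain[OF \<kappa>(1) _ \<kappa>(4) _ fV l c])
        (use \<kappa> in \<open>auto intro: less_imp_le\<close>)
    then show False using fC by simp
  qed
  have "emeasure M {x \<in> space M. \<bar>f x\<bar> > l} < \<infinity>" if l: "0 < l" for l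
  proof -
    have "{x \<in> space M. \<bar>f x\<bar> > l}
        = {x \<in> space M. 1 * f x > l} \<union> {x \<in> space M. (- 1) * f x > l}"
      by auto
    then have "emeasure M {x \<in> space M. \<bar>f x\<bar> > l}
        \<le> emeasure M {x \<in> space M. 1 * f x > l} + emeasure M {x \<in> space M. (- 1) * f x > l}"
      by (simp only:) (rule emeasure_subadditive; measurable)
    also have "\<dots> < \<infinity>"
      using no_large[OF l, of 1] no_large[OF l, of "- 1"] by (simp add: less_top[symmetric])
    finally show ?thesis .
  qed
  then show "f \<in> R_space M" using fV by (simp add: R_space_iff)
qed

lemma R_space_subset_C_space:
  assumes "sigma_finite_measure M"
  shows "R_space M \<subseteq> C_space M"
proof
  fix f assume f: "f \<in> R_space M"
  show "f \<in> C_space M"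
    unfolding C_space_def
  proof (intro CollectI conjI allI impI)
    show "f \<in> L1_plus_Linf M" using f by (simp add: R_space_iff)
    fix T assume "dunford_schwartz M T"
    then interpret dunford_schwartz_operator M T
      using assms by (simp add: dunford_schwartz_operator_def dunford_schwartz_operator_axioms_def)
    show "AE x in M. convergent (\<lambda>n. ergodic_average T n f x)"
      using f by (intro average_convergent) (auto simp: R_space_iff)
  qed
qed

theorem theorem3p4:
  fixes M :: "'a measure"
  assumes "complete_measure M"
    and "sigma_finite_measure M"
    and "emeasure M (space M) = \<infinity>"
    and "quasi_non_atomic M"
  shows "C_space M = R_space M"
  using C_space_subset_R_space[OF assms(2)] R_space_subset_C_space[OF assms(2)] by blast

end
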